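(* Let $D,D' \subset \mathbb{C}$ be $C^2$-smoothly bounded domains equipped with their Kobayashi--Fuks metrics $ds^2_{\tilde B,D}$ and $ds^2_{\tilde B,D'}$ respectively. Then every isometry $f: (D, ds^2_{\tilde B,D}) \to (D', ds^2_{\tilde B,D'})$ is either holomorphic or conjugate holomorphic.
   Context: For a bounded domain $D\subset\mathbb{C}$, $A^2(D)$ is the Hilbert space of square-integrable (with respect to Lebesgue measure) holomorphic functions on $D$, $K_D(z,w)$ is its reproducing kernel (the Bergman kernel), and $K_D(z)=K_D(z,z)$. Put $g_{B,D}=\frac{\partial^2\log K_D}{\partial z\,\partial\bar z}$ (the Bergman metric). The Kobayashi--Fuks metric of $D$ is $ds^2_{\tilde B,D}=g_{\tilde B,D}(z)|dz|^2$ where $g_{\tilde B,D}=\frac{\partial^2\log(K_D^2\,g_{B,D})}{\partial z\,\partial\bar z}$, which is known to be strictly positive. *)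

theory Defs
  imports "HOL-Complex_Analysis.Complex_Analysis"
begin

definition C1_on :: "'a::real_normed_vector set \<Rightarrow> ('a \<Rightarrow> 'b::real_normed_vector) \<Rightarrow> bool" where
  "C1_on U f \<longleftrightarrow>
     (\<exists>f'. (\<forall>x\<in>U. (f has_derivative blinfun_apply (f' x)) (at x)) \<and> continuous_on U f')"

definition C2_on :: "'a::real_normed_vector set \<Rightarrow> ('a \<Rightarrow> 'b::real_normed_vector) \<Rightarrow> bool" where
  "C2_on U f \<longleftrightarrow>
     (\<exists>f'. (\<forall>x\<in>U. (f has_derivative blinfun_apply (f' x)) (at x)) \<and> C1_on U f')"

text \<open>A bounded domain that near each boundary point \<open>p\<close> is the negativity set of a real
  \<open>C\<^sup>2\<close> function \<open>r\<close> with nonvanishing differential at \<open>p\<close>.\<close>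

definition C2_smoothly_bounded_domain :: "complex set \<Rightarrow> bool" where
  "C2_smoothly_bounded_domain D \<longleftrightarrow>
     open D \<and> connected D \<and> D \<noteq> {} \<and> bounded D \<and>
     (\<forall>p\<in>frontier D. \<exists>U (r :: complex \<Rightarrow> real).
        open U \<and> p \<in> U \<and> C2_on U r \<and> D \<inter> U = {z \<in> U. r z < 0} \<and>
        frechet_derivative r (at p) \<noteq> (\<lambda>v. 0))"

definition bergman_space :: "complex set \<Rightarrow> (complex \<Rightarrow> complex) set" where
  "bergman_space D = {f. f holomorphic_on D \<and> set_integrable lborel D (\<lambda>z. (cmod (f z))\<^sup>2)}"

definition bergman_inner :: "complex set \<Rightarrow> (complex \<Rightarrow> complex) \<Rightarrow> (complex \<Rightarrow> complex) \<Rightarrow> complex" where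
  "bergman_inner D f g = (LINT z:D|lborel. f z * cnj (g z))"

definition is_reproducing_kernel :: "complex set \<Rightarrow> (complex \<Rightarrow> complex \<Rightarrow> complex) \<Rightarrow> bool" where
  "is_reproducing_kernel D K \<longleftrightarrow>
     (\<forall>w\<in>D. (\<lambda>z. K z w) \<in> bergman_space D \<and>
            (\<forall>f\<in>bergman_space D. f w = bergman_inner D f (\<lambda>z. K z w)))"

text \<open>The reproducing kernel is determined only on \<open>D \<times> D\<close>; extending it by \<open>0\<close> makes it
  unique as a total function.\<close>

definition bergman_kernel :: "complex set \<Rightarrow> complex \<Rightarrow> complex \<Rightarrow> complex" where
  "bergman_kernel D =
     (THE K. is_reproducing_kernel D K \<and> (\<forall>z w. z \<notin> D \<or> w \<notin> D \<longrightarrow> K z w = 0))"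

text \<open>\<open>K\<^sub>D(z,z)\<close> is real and nonnegative, so taking the real part loses nothing.\<close>

definition bergman_kernel_diag :: "complex set \<Rightarrow> complex \<Rightarrow> real" where
  "bergman_kernel_diag D z = Re (bergman_kernel D z z)"

text \<open>Wirtinger derivatives \<open>(\<partial>\<^sub>x - i \<partial>\<^sub>y)/2\<close> and \<open>(\<partial>\<^sub>x + i \<partial>\<^sub>y)/2\<close>.\<close>

definition wirtinger_dz :: "(complex \<Rightarrow> complex) \<Rightarrow> complex \<Rightarrow> complex" where
  "wirtinger_dz u z =
     (frechet_derivative u (at z) 1 - \<i> * frechet_derivative u (at z) \<i>) / 2"

definition wirtinger_dzbar :: "(complex \<Rightarrow> complex) \<Rightarrow> complex \<Rightarrow> complex" where
  "wirtinger_dzbar u z =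
     (frechet_derivative u (at z) 1 + \<i> * frechet_derivative u (at z) \<i>) / 2"

text \<open>For a real \<open>C\<^sup>2\<close> function the mixed derivative is a quarter of the Laplacian, hence real.\<close>

definition dz_dzbar :: "(complex \<Rightarrow> real) \<Rightarrow> complex \<Rightarrow> real" where
  "dz_dzbar u z = Re (wirtinger_dz (wirtinger_dzbar (\<lambda>\<zeta>. complex_of_real (u \<zeta>))) z)"

definition bergman_metric :: "complex set \<Rightarrow> complex \<Rightarrow> real" where
  "bergman_metric D = dz_dzbar (\<lambda>z. ln (bergman_kernel_diag D z))"

definition kobayashi_fuks_metric :: "complex set \<Rightarrow> complex \<Rightarrow> real" where
  "kobayashi_fuks_metric D =
     dz_dzbar (\<lambda>z. ln ((bergman_kernel_diag D z)\<^sup>2 * bergman_metric D z))"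

text \<open>Riemannian isometries of the conformal metrics \<open>g |dz|\<^sup>2\<close> on \<open>D\<close> and \<open>g' |dz|\<^sup>2\<close> on \<open>D'\<close>:
  diffeomorphisms under which the second metric pulls back to the first. By polarization it
  suffices to compare the quadratic forms. Only \<open>C\<^sup>1\<close> regularity is asked, so smooth
  isometries are included; neither holomorphy nor preservation of orientation is assumed.\<close>

definition riemannian_isometry ::
    "complex set \<Rightarrow> (complex \<Rightarrow> real) \<Rightarrow> complex set \<Rightarrow> (complex \<Rightarrow> real) \<Rightarrow>
     (complex \<Rightarrow> complex) \<Rightarrow> bool" where
  "riemannian_isometry D g D' g' f \<longleftrightarrow>
     bij_betw f D D' \<and> C1_on D f \<and> C1_on D' (inv_into D f) \<and>
     (\<forall>z\<in>D. \<forall>v. g' (f z) * (cmod (frechet_derivative f (at z) v))\<^sup>2 = g z * (cmod v)\<^sup>2)"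

end

theory Submission
  imports Defs
begin

text \<open>
In one complex variable a metric \<open>g |dz|\<^sup>2\<close> with \<open>g > 0\<close> is conformal to the Euclidean one, so an
isometry between two such metrics is a conformal map: each differential \<open>df\<^sub>z\<close> multiplies all lengths
by one positive factor, hence is either \<open>v \<mapsto> a v\<close> or \<open>v \<mapsto> a cnj v\<close> with
\<open>a \<noteq> 0\<close>. Both alternatives are closed conditions on \<open>z\<close> because \<open>f\<close> is \<open>C\<^sup>1\<close>, and they exclude each
other, so one of them holds on the whole connected domain
(\<open>riemannian_isometry_imp_holomorphic_or_antiholomorphic\<close>). What carries the weight is the
strict positivity of the Kobayashi--Fuks metric on every bounded open set
(\<open>kobayashi_fuks_metric_pos\<close>).

For the positivity, every functional \<open>f \<mapsto> f\<^sup>(\<^sup>k\<^sup>)(w)\<close> on the Bergman space is represented by some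
\<open>e\<^sub>k(w)\<close> (\<open>derivative_representer_exists\<close>). The representer is a multiple of the function of least norm
in \<open>{f. f\<^sup>(\<^sup>k\<^sup>)(w) = 1}\<close>, and that function exists by Montel's theorem and Fatou's lemma; the
local boundedness that Montel's theorem asks for is the area mean value property applied to the
square of \<open>f\<close>. Then \<open>e\<^sub>0(w)\<close> is the Bergman kernel \<open>K(\<cdot>,w)\<close>, and the inner products
\<open>g\<^sub>j\<^sub>k(z) = \<langle>e\<^sub>k(z), e\<^sub>j(z)\<rangle>\<close> form a family with \<open>K(z) = g\<^sub>0\<^sub>0(z)\<close> that is closed under differentiation:
\<open>\<partial>g\<^sub>j\<^sub>k/\<partial>z = g\<^sub>j\<^sub>+\<^sub>1\<^sub>,\<^sub>k\<close> and the conjugate derivative raises \<open>k\<close> instead (\<open>jet_has_wirtinger\<close>). All the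
derivatives in the definitions of the two metrics thus become polynomials in the \<open>g\<^sub>j\<^sub>k\<close>.

Since the mixed derivative of \<open>log h\<close> is \<open>(h h\<^sub>1\<^sub>2 - h\<^sub>1 h\<^sub>2) / h\<^sup>2\<close>, the function \<open>K\<^sup>2 g\<^sub>B\<close> is the Gram
determinant \<open>M = g\<^sub>0\<^sub>0 g\<^sub>1\<^sub>1 - g\<^sub>1\<^sub>0 g\<^sub>0\<^sub>1\<close> of \<open>e\<^sub>0, e\<^sub>1\<close>, and \<open>M\<^sup>2\<close> times the Kobayashi--Fuks metric is
\<open>M M\<^sub>1\<^sub>2 - M\<^sub>1 M\<^sub>2\<close>, which by Sylvester's determinant identity equals \<open>g\<^sub>0\<^sub>0\<close> times the Gram determinant
of \<open>e\<^sub>0, e\<^sub>1, e\<^sub>2\<close>. Both determinants are positive because \<open>e\<^sub>0, e\<^sub>1, e\<^sub>2\<close> are linearly independent: the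
polynomials \<open>1\<close>, \<open>\<zeta> - z\<close>, \<open>(\<zeta> - z)\<^sup>2\<close> lie in the Bergman space of a bounded set and separate the three
functionals.
\<close>


section \<open>Conformal maps of class \<open>C\<^sup>1\<close>\<close>

text \<open>The claim is \<open>(T 1)\<^sup>2 + (T \<i>)\<^sup>2 = 0\<close>, which factors into the two alternatives. It says that \<open>T 1\<close>
and \<open>T \<i>\<close> have equal length and are orthogonal; the length of \<open>T (1 + \<i>)\<close> gives the orthogonality.\<close>

lemma conformal_linear_cases:
  fixes T :: "complex \<Rightarrow> complex"
  assumes T: "linear T" and c: "\<And>v. (cmod (T v))\<^sup>2 = c * (cmod v)\<^sup>2"
  shows "T \<i> = \<i> * T 1 \<or> T \<i> = - (\<i> * T 1)"
proof -
  obtain a1 a2 b1 b2 where ab: "T 1 = Complex a1 a2" "T \<i> = Complex b1 b2"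
    by (metis complex.exhaust)
  have "T (1 + \<i>) = T 1 + T \<i>"
    using T by (rule linear_add)
  then have e3: "(a1 + b1)\<^sup>2 + (a2 + b2)\<^sup>2 = 2 * c"
    using c[of "1 + \<i>"] by (simp add: ab cmod_power2)
  have e1: "a1\<^sup>2 + a2\<^sup>2 = c" and e2: "b1\<^sup>2 + b2\<^sup>2 = c"
    using c[of 1] c[of \<i>] by (simp_all add: ab cmod_power2)
  have ortho: "a1 * b1 + a2 * b2 = 0"
    using e1 e2 e3 by (simp add: power2_eq_square algebra_simps)
  have diff: "a1\<^sup>2 + a2\<^sup>2 - b1\<^sup>2 - b2\<^sup>2 = 0"
    using e1 e2 by simp
  have "(T \<i> - \<i> * T 1) * (T \<i> + \<i> * T 1) = (T 1)\<^sup>2 + (T \<i>)\<^sup>2"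
    by (simp add: algebra_simps power2_eq_square)
  also have "\<dots> = 0"
  proof (rule ccontr)
    assume nz: "(T 1)\<^sup>2 + (T \<i>)\<^sup>2 \<noteq> 0"
    define u v where "u = a1\<^sup>2 - a2\<^sup>2 + b1\<^sup>2 - b2\<^sup>2" and "v = a1 * a2 + b1 * b2"
    have uv: "(T 1)\<^sup>2 + (T \<i>)\<^sup>2 = Complex u (2 * v)"
      by (simp add: ab u_def v_def complex_eq_iff power2_eq_square algebra_simps)
    \<comment> \<open>this compares the squared modulus of \<open>(T 1)\<^sup>2 + (T \<i>)\<^sup>2\<close> with the defects of length and orthogonality\<close>
    have "u\<^sup>2 + (2 * v)\<^sup>2 = (a1\<^sup>2 + a2\<^sup>2 - b1\<^sup>2 - b2\<^sup>2)\<^sup>2 + 4 * (a1 * b1 + a2 * b2)\<^sup>2"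
      unfolding u_def v_def by algebra
    also have "\<dots> = 0"
      using ortho diff by simp
    finally have "u = 0 \<and> 2 * v = 0"
      by (simp only: sum_power2_eq_zero_iff)
    then show False
      using nz uv by (simp add: complex_eq_iff)
  qed
  finally show ?thesis
    by (auto simp: add_eq_0_iff)
qed

lemma real_linear_complex:
  fixes T :: "complex \<Rightarrow> complex"
  assumes "linear T"
  shows "T v = Re v *\<^sub>R T 1 + Im v *\<^sub>R T \<i>"
proof -
  have "T v = T (Re v *\<^sub>R 1 + Im v *\<^sub>R \<i>)"
    by (rule arg_cong[of _ _ T]) (simp add: complex_eq_iff)
  then show ?thesis
    using assms by (simp only: linear_add linear_scale)
qed

text \<open>The points where the differential is complex linear and those where it is antilinear are two
disjoint relatively closed sets that cover \<open>D\<close>, so connectedness leaves only one of them.\<close>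

lemma conformal_C1_imp_holomorphic_or_antiholomorphic:
  fixes f :: "complex \<Rightarrow> complex"
  assumes "open D" "connected D" and C1: "C1_on D f"
    and conf: "\<And>z. z \<in> D \<Longrightarrow> \<exists>c>0. \<forall>v. (cmod (frechet_derivative f (at z) v))\<^sup>2 = c * (cmod v)\<^sup>2"
  shows "f holomorphic_on D \<or> (\<lambda>z. cnj (f z)) holomorphic_on D"
proof -
  obtain f' where f': "\<And>z. z \<in> D \<Longrightarrow> (f has_derivative blinfun_apply (f' z)) (at z)"
    and cont: "continuous_on D f'"
    using C1 unfolding C1_on_def by blast
  define a b where "a = (\<lambda>z. blinfun_apply (f' z) 1)" and "b = (\<lambda>z. blinfun_apply (f' z) \<i>)"
  have lin: "linear (blinfun_apply (f' z))" for z
    by (simp add: blinfun.bounded_linear_right bounded_linear.linear)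
  have ab_cases: "(b z = \<i> * a z \<or> b z = - (\<i> * a z)) \<and> a z \<noteq> 0" if z: "z \<in> D" for z
  proof -
    have fd: "frechet_derivative f (at z) = blinfun_apply (f' z)"
      using f'[OF z] by (metis frechet_derivative_at)
    obtain c where c: "c > 0" "\<And>v. (cmod (f' z v))\<^sup>2 = c * (cmod v)\<^sup>2"
      using conf[OF z] unfolding fd by blast
    have "a z \<noteq> 0"
      using c(1) c(2)[of 1] by (auto simp: a_def)
    then show ?thesis
      using conformal_linear_cases[OF lin c(2)] by (auto simp: a_def b_def)
  qed
  have conts: "continuous_on D a" "continuous_on D b"
    unfolding a_def b_def by (intro continuous_intros cont)+
  define P where "P = {z \<in> D. b z - \<i> * a z = 0}"
  define N where "N = {z \<in> D. b z + \<i> * a z = 0}"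
  have "closedin (top_of_set D) P" "closedin (top_of_set D) N"
    unfolding P_def N_def
    by (intro continuous_closedin_preimage_constant continuous_intros conts)+
  moreover have "P \<union> N = D"
    using ab_cases by (fastforce simp: P_def N_def add_eq_0_iff)
  moreover have "P \<inter> N = {}"
    using ab_cases by (fastforce simp: P_def N_def)
  ultimately have "P = {} \<or> N = {}"
    using \<open>connected D\<close> unfolding connected_closedin_eq by blast
  then consider "P = D" | "N = D"
    using \<open>P \<union> N = D\<close> by blast
  then show ?thesis
  proof cases
    case 1
    have "(f has_field_derivative a z) (at z)" if "z \<in> D" for z
    proof -
      have bz: "f' z \<i> = \<i> * a z"
        using 1 that by (auto simp: P_def b_def)
      have "blinfun_apply (f' z) = (\<lambda>v. a z * v)"
      proof
        fix v
        have "f' z v = Re v *\<^sub>R a z + Im v *\<^sub>R (\<i> * a z)"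
          using real_linear_complex[OF lin, of z v] unfolding bz a_def .
        also have "\<dots> = a z * v"
          by (simp add: complex_eq_iff algebra_simps)
        finally show "f' z v = a z * v" .
      qed
      then show ?thesis
        using f'[OF that] by (simp add: has_field_derivative_def)
    qed
    then have "f holomorphic_on D"
      using \<open>open D\<close> by (meson holomorphic_on_open)
    then show ?thesis ..
  next
    case 2
    have "((\<lambda>z. cnj (f z)) has_field_derivative cnj (a z)) (at z)" if "z \<in> D" for z
    proof -
      have bz: "f' z \<i> = - (\<i> * a z)"
        using 2 that unfolding N_def b_def by (auto simp only: mem_Collect_eq eq_neg_iff_add_eq_0)
      have "(\<lambda>v. cnj (blinfun_apply (f' z) v)) = (\<lambda>v. cnj (a z) * v)"
      proof
        fix v
        have "f' z v = Re v *\<^sub>R a z + Im v *\<^sub>R (- (\<i> * a z))"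
          using real_linear_complex[OF lin, of z v] unfolding bz a_def .
        also have "cnj \<dots> = cnj (a z) * v"
          by (simp add: complex_eq_iff algebra_simps)
        finally show "cnj (f' z v) = cnj (a z) * v" .
      qed
      then show ?thesis
        using has_derivative_cnj[OF f'[OF that]] by (simp add: has_field_derivative_def)
    qed
    then have "(\<lambda>z. cnj (f z)) holomorphic_on D"
      using \<open>open D\<close> by (meson holomorphic_on_open)
    then show ?thesis ..
  qed
qed

lemma riemannian_isometry_imp_holomorphic_or_antiholomorphic:
  assumes "open D" "connected D"
    and iso: "riemannian_isometry D g D' g' f"
    and g: "\<And>z. z \<in> D \<Longrightarrow> 0 < g z" and g': "\<And>z. z \<in> D' \<Longrightarrow> 0 < g' z"
  shows "f holomorphic_on D \<or> (\<lambda>z. cnj (f z)) holomorphic_on D"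
proof (rule conformal_C1_imp_holomorphic_or_antiholomorphic[OF assms(1,2)])
  show "C1_on D f"
    using iso unfolding riemannian_isometry_def by blast
  fix z assume z: "z \<in> D"
  have "f z \<in> D'"
    using iso z unfolding riemannian_isometry_def by (blast dest: bij_betwE)
  then have pos: "0 < g' (f z)"
    by (rule g')
  have "\<forall>v. g' (f z) * (cmod (frechet_derivative f (at z) v))\<^sup>2 = g z * (cmod v)\<^sup>2"
    using iso z unfolding riemannian_isometry_def by blast
  then have "\<forall>v. (cmod (frechet_derivative f (at z) v))\<^sup>2 = g z / g' (f z) * (cmod v)\<^sup>2"
    using pos by (simp add: field_simps)
  moreover have "0 < g z / g' (f z)"
    using pos g[OF z] by simp
  ultimately show "\<exists>c>0. \<forall>v. (cmod (frechet_derivative f (at z) v))\<^sup>2 = c * (cmod v)\<^sup>2"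
    by blast
qed

section \<open>Wirtinger derivatives\<close>

text \<open>Total differentiability is part of the notion: only then does \<open>frechet_derivative\<close>, from which both
Wirtinger derivatives are read off, have its meaning.\<close>

definition has_wirtinger :: "(complex \<Rightarrow> complex) \<Rightarrow> complex \<Rightarrow> complex \<Rightarrow> complex \<Rightarrow> bool" where
  "has_wirtinger f a b z \<longleftrightarrow> (f has_derivative (\<lambda>v. a * v + b * cnj v)) (at z)"

lemma has_wirtinger_imp_wirtinger_dz: "has_wirtinger f a b z \<Longrightarrow> wirtinger_dz f z = a"
  and has_wirtinger_imp_wirtinger_dzbar: "has_wirtinger f a b z \<Longrightarrow> wirtinger_dzbar f z = b"
proof -
  assume "has_wirtinger f a b z"
  then have "frechet_derivative f (at z) = (\<lambda>v. a * v + b * cnj v)"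
    unfolding has_wirtinger_def by (metis frechet_derivative_at)
  then show "wirtinger_dz f z = a" "wirtinger_dzbar f z = b"
    by (simp_all add: wirtinger_dz_def wirtinger_dzbar_def algebra_simps)
qed

lemma has_wirtinger_transform:
  assumes "has_wirtinger f a b z" "open D" "z \<in> D" "\<And>x. x \<in> D \<Longrightarrow> f x = g x"
  shows "has_wirtinger g a b z"
  using assms unfolding has_wirtinger_def by (rule has_derivative_transform_within_open)

lemma has_wirtinger_diff:
  assumes "has_wirtinger f a b z" "has_wirtinger g c d z"
  shows "has_wirtinger (\<lambda>x. f x - g x) (a - c) (b - d) z"
  using has_derivative_diff[OF assms[unfolded has_wirtinger_def]]
  by (simp add: has_wirtinger_def algebra_simps)

lemma has_wirtinger_mult:
  assumes "has_wirtinger f a b z" "has_wirtinger g c d z"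
  shows "has_wirtinger (\<lambda>x. f x * g x) (a * g z + f z * c) (b * g z + f z * d) z"
  using has_derivative_mult[OF assms[unfolded has_wirtinger_def]]
  by (simp add: has_wirtinger_def algebra_simps)

lemma has_wirtinger_holomorphic_compose:
  assumes "has_wirtinger f a b z" "(F has_field_derivative F') (at (f z))"
  shows "has_wirtinger (\<lambda>x. F (f x)) (F' * a) (F' * b) z"
  using has_derivative_compose[of f _ z UNIV F, OF assms(1)[unfolded has_wirtinger_def]
      assms(2)[unfolded has_field_derivative_def]]
  by (simp add: has_wirtinger_def algebra_simps)

lemma has_wirtinger_divide:
  assumes "has_wirtinger f a b z" "has_wirtinger g c d z" "g z \<noteq> 0"
  shows "has_wirtinger (\<lambda>x. f x / g x) ((a * g z - f z * c) / (g z)\<^sup>2) ((b * g z - f z * d) / (g z)\<^sup>2) z"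
proof -
  have "(inverse has_field_derivative - inverse ((g z)\<^sup>2)) (at (g z))"
    using DERIV_inverse[OF assms(3)] by (simp add: numeral_2_eq_2)
  from has_wirtinger_mult[OF assms(1) has_wirtinger_holomorphic_compose[OF assms(2) this]]
  have "has_wirtinger (\<lambda>x. f x * inverse (g x))
     (a * inverse (g z) + f z * (- inverse ((g z)\<^sup>2) * c)) (b * inverse (g z) + f z * (- inverse ((g z)\<^sup>2) * d)) z" .
  moreover have "s * inverse (g z) + f z * (- inverse ((g z)\<^sup>2) * t) = (s * g z - f z * t) / (g z)\<^sup>2" for s t
    using assms(3) by (simp add: field_simps power2_eq_square)
  ultimately show ?thesis
    by (simp add: divide_inverse)
qed

text \<open>The complex logarithm of \<open>h\<close> is used in place of the real one of \<open>u\<close>, so that only the chain rule for a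
holomorphic outer function is called for. The derivatives \<open>p, q\<close> of \<open>h\<close> are asked for on all of \<open>D\<close>,
because the inner derivative is differentiated once more.\<close>

lemma dz_dzbar_ln:
  assumes "open D" "z \<in> D"
    and u: "\<And>x. x \<in> D \<Longrightarrow> complex_of_real (u x) = h x" "\<And>x. x \<in> D \<Longrightarrow> 0 < u x"
    and h: "\<And>x. x \<in> D \<Longrightarrow> has_wirtinger h (p x) (q x) x"
    and q: "has_wirtinger q r s z"
  shows "dz_dzbar (\<lambda>x. ln (u x)) z = Re ((h z * r - p z * q z) / (h z)\<^sup>2)"
proof -
  have Ln: "has_wirtinger (\<lambda>x. complex_of_real (ln (u x))) (p x / h x) (q x / h x) x" if x: "x \<in> D" for x
  proof (rule has_wirtinger_transform[OF _ \<open>open D\<close> x])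
    have "h x \<notin> \<real>\<^sub>\<le>\<^sub>0"
      using u(2)[OF x] unfolding u(1)[OF x, symmetric] by simp
    from has_wirtinger_holomorphic_compose[OF h[OF x] has_field_derivative_Ln[OF this]]
    show "has_wirtinger (\<lambda>y. Ln (h y)) (p x / h x) (q x / h x) x"
      by (simp add: field_simps)
    show "Ln (h y) = complex_of_real (ln (u y))" if "y \<in> D" for y
      using u[OF that] by (metis Ln_of_real)
  qed
  have "h z \<noteq> 0"
    using u[OF \<open>z \<in> D\<close>] by auto
  have "has_wirtinger (wirtinger_dzbar (\<lambda>x. complex_of_real (ln (u x))))
      ((r * h z - q z * p z) / (h z)\<^sup>2) ((s * h z - q z * q z) / (h z)\<^sup>2) z"
    using has_wirtinger_divide[OF q h[OF \<open>z \<in> D\<close>] \<open>h z \<noteq> 0\<close>] \<open>open D\<close> \<open>z \<in> D\<close>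
    by (rule has_wirtinger_transform) (simp add: has_wirtinger_imp_wirtinger_dzbar[OF Ln])
  then show ?thesis
    unfolding dz_dzbar_def by (simp add: has_wirtinger_imp_wirtinger_dz mult.commute)
qed

section \<open>Rotation invariance of area and the mean value property\<close>

text \<open>This identification transports the invariance of the area under orthogonal maps from \<open>real ^ 2\<close>, where
linear maps are matrices with a determinant, to the complex plane.\<close>

definition plane_to_complex :: "real ^ 2 \<Rightarrow> complex" where
  "plane_to_complex v = Complex (v $ 1) (v $ 2)"

definition complex_to_plane :: "complex \<Rightarrow> real ^ 2" where
  "complex_to_plane z = vector [Re z, Im z]"

lemma plane_to_complex_inverse [simp]:
  "plane_to_complex (complex_to_plane z) = z" "complex_to_plane (plane_to_complex v) = v"
  by (simp_all add: plane_to_complex_def complex_to_plane_def vec_eq_iff forall_2)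

lemma linear_plane_to_complex: "linear plane_to_complex"
  by (rule linearI) (simp_all add: plane_to_complex_def complex_eq_iff)

lemma linear_complex_to_plane: "linear complex_to_plane"
  by (rule linearI) (simp_all add: complex_to_plane_def vec_eq_iff forall_2)

lemma norm_plane_to_complex [simp]: "norm (plane_to_complex v) = norm v"
  by (simp add: plane_to_complex_def norm_eq_sqrt_inner inner_vec_def sum_2 inner_complex_def)

lemma measurable_plane_to_complex [measurable]: "plane_to_complex \<in> borel_measurable borel"
  by (intro borel_measurable_continuous_onI linear_continuous_on linear_plane_to_complex
      linear_conv_bounded_linear[THEN iffD1])

lemma plane_to_complex_vimage_box:
  "plane_to_complex -` box l u = box (complex_to_plane l) (complex_to_plane u)"
  by (auto simp: plane_to_complex_def complex_to_plane_def mem_box_cart forall_2 in_box_complex_iff)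

lemma distr_plane_to_complex: "distr lborel borel plane_to_complex = lborel"
proof (rule lborel_eqI[symmetric])
  fix l u :: complex
  assume le: "\<And>b. b \<in> Basis \<Longrightarrow> l \<bullet> b \<le> u \<bullet> b"
  have le': "Re l \<le> Re u" "Im l \<le> Im u"
    using le[of 1] le[of \<i>] by (simp_all add: Basis_complex_def)
  define a b where "a = complex_to_plane l" and "b = complex_to_plane u"
  have "emeasure lborel (box a b) = emeasure lborel (cbox a b)"
    by (simp add: emeasure_lborel_box_eq emeasure_lborel_cbox_eq)
  also have "\<dots> = ennreal (measure lborel (cbox a b))"
    using emeasure_lborel_cbox_finite[of a b] by (intro emeasure_eq_ennreal_measure) auto
  also have "measure lborel (cbox a b) = (Re u - Re l) * (Im u - Im l)"
    using le' by (subst content_cbox_cart)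
      (auto simp: a_def b_def complex_to_plane_def forall_2 UNIV_2 interval_ne_empty_cart)
  finally show "emeasure (distr lborel borel plane_to_complex) (box l u) = (\<Prod>b\<in>Basis. (u - l) \<bullet> b)"
    by (simp add: emeasure_distr plane_to_complex_vimage_box a_def b_def Basis_complex_def)
qed simp

text \<open>A rotated box is in general no box, so the invariance of the area cannot be read off from products of
side lengths; it comes from orthogonal maps of the real plane.\<close>

lemma distr_rotation:
  fixes c :: complex
  assumes "cmod c = 1"
  shows "distr lborel borel (\<lambda>z. c * z) = (lborel :: complex measure)"
proof (rule lborel_eqI[symmetric])
  fix l u :: complex
  assume le: "\<And>b. b \<in> Basis \<Longrightarrow> l \<bullet> b \<le> u \<bullet> b"
  define T where "T = complex_to_plane \<circ> (\<lambda>z. cnj c * z) \<circ> plane_to_complex"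
  define S where "S = plane_to_complex -` box l u"
  have cc: "c * cnj c = 1" "cnj c * c = 1"
    using assms by (simp_all add: complex_norm_square[symmetric] mult.commute[of "cnj c"])
  have "linear (\<lambda>z. cnj c * z)"
    by (simp add: bounded_linear_mult_right bounded_linear.linear)
  then have "linear T"
    unfolding T_def by (intro linear_compose linear_plane_to_complex linear_complex_to_plane)
  moreover have "norm (T v) = norm v" for v
    using assms by (simp add: T_def norm_mult flip: norm_plane_to_complex)
  ultimately have "orthogonal_transformation T"
    by (simp add: orthogonal_transformation)
  have S_box: "S = box (complex_to_plane l) (complex_to_plane u)"
    by (simp add: S_def plane_to_complex_vimage_box)
  then have S: "S \<in> lmeasurable" "S \<in> sets borel"
    by simp_all
  have vimage: "plane_to_complex -` ((\<lambda>z. c * z) -` box l u) = T ` S"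
  proof (intro set_eqI iffI)
    fix v assume "v \<in> plane_to_complex -` ((\<lambda>z. c * z) -` box l u)"
    then have "complex_to_plane (c * plane_to_complex v) \<in> S"
      by (simp add: S_def)
    moreover have "v = T (complex_to_plane (c * plane_to_complex v))"
      by (simp add: T_def mult.assoc[symmetric] cc)
    ultimately show "v \<in> T ` S"
      by blast
  next
    fix v assume "v \<in> T ` S"
    then show "v \<in> plane_to_complex -` ((\<lambda>z. c * z) -` box l u)"
      by (auto simp: S_def T_def mult.assoc[symmetric] cc)
  qed
  have meas: "(\<lambda>z. c * z) -` box l u \<in> sets borel"
    using measurable_sets_borel[of "\<lambda>z. c * z" borel "box l u"] by simp
  have meas': "T ` S \<in> sets borel"
    unfolding vimage[symmetric] using measurable_sets_borel[OF measurable_plane_to_complex meas] by simp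
  have lm: "T ` S \<in> lmeasurable"
    using \<open>orthogonal_transformation T\<close> S(1) by (rule measurable_orthogonal_image)
  have "emeasure (distr lborel borel (\<lambda>z. c * z)) (box l u) = emeasure lborel ((\<lambda>z. c * z) -` box l u)"
    by (simp add: emeasure_distr)
  also have "\<dots> = emeasure lborel (T ` S)"
    by (subst distr_plane_to_complex[symmetric]) (simp add: emeasure_distr meas vimage)
  also have "\<dots> = emeasure lebesgue (T ` S)"
    using meas' by simp
  also have "\<dots> = emeasure lebesgue S"
    using lm S(1) measure_orthogonal_image[OF \<open>orthogonal_transformation T\<close> S(1)]
    by (simp add: emeasure_eq_measure2)
  also have "\<dots> = emeasure lborel S"
    using S(2) by simp
  also have "\<dots> = emeasure lborel (box l u)"
    unfolding S_def
    by (subst distr_plane_to_complex[symmetric], subst emeasure_distr) simp_all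
  also have "\<dots> = (\<Prod>b\<in>Basis. (u - l) \<bullet> b)"
    using le by (rule emeasure_lborel_box)
  finally show "emeasure (distr lborel borel (\<lambda>z. c * z)) (box l u) = (\<Prod>b\<in>Basis. (u - l) \<bullet> b)" .
qed simp

text \<open>The rotation by \<open>\<pi> / n\<close> preserves the disc and changes the sign of \<open>z\<^sup>n\<close>.\<close>

lemma integral_ball_power:
  assumes "n > 0"
  shows "(LINT z:ball 0 r|lborel. z ^ n :: complex) = 0"
proof -
  define c where "c = cis (pi / n)"
  have "cmod c = 1" and "c ^ n = -1"
    using assms by (simp_all add: c_def Complex.DeMoivre complex_eq_iff)
  let ?I = "LINT z:ball 0 r|lborel. z ^ n :: complex"
  have "?I = (LINT z|distr lborel borel (\<lambda>z. c * z). indicator (ball 0 r) z *\<^sub>R z ^ n)"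
    by (simp add: set_lebesgue_integral_def distr_rotation \<open>cmod c = 1\<close>)
  also have "\<dots> = (LINT z|lborel. indicator (ball 0 r) (c * z) *\<^sub>R (c * z) ^ n)"
    by (subst integral_distr) (auto intro!: borel_measurable_continuous_on_indicator continuous_intros)
  also have "\<dots> = (LINT z|lborel. - (indicator (ball 0 r) z *\<^sub>R z ^ n))"
    by (intro Bochner_Integration.integral_cong)
      (auto simp: indicator_def norm_mult \<open>cmod c = 1\<close> \<open>c ^ n = -1\<close> power_mult_distrib)
  also have "\<dots> = - ?I"
    by (simp add: set_lebesgue_integral_def)
  finally show ?thesis
    by simp
qed

text \<open>Integrating the Taylor series of \<open>h\<close> about the centre term by term leaves the constant term only. The
radius \<open>R > r\<close> makes the series absolutely convergent on the closed disc of radius \<open>r\<close>, which dominates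
the interchange.\<close>

lemma area_mean_value:
  fixes h :: "complex \<Rightarrow> complex"
  assumes "h holomorphic_on ball w R" and "r < R" "0 < r"
  shows "(LINT z:ball w r|lborel. h z) = measure lborel (ball w r) * h w"
proof -
  define a where "a n = (deriv ^^ n) h w / fact n" for n
  have sums: "(\<lambda>n. a n * z ^ n) sums h (w + z)" if "norm z < R" for z
    using holomorphic_power_series[OF assms(1), of "w + z"] that by (simp add: a_def dist_norm)
  obtain \<rho> where \<rho>: "r < \<rho>" "\<rho> < R"
    using \<open>r < R\<close> dense by blast
  have "summable (\<lambda>n. norm (a n * of_real r ^ n))"
    using sums[of "of_real \<rho>"] \<rho> \<open>0 < r\<close> by (intro powser_insidea[of a "of_real \<rho>"]) (auto simp: sums_iff)
  then have summ: "summable (\<lambda>n. norm (a n) * r ^ n)"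
    using \<open>0 < r\<close> by (simp add: norm_mult norm_power)
  define F where "F n z = indicator (ball 0 r) z *\<^sub>R (a n * z ^ n)" for n and z :: complex
  have ball_int: "integrable lborel (\<lambda>z :: complex. indicator (ball 0 r) z *\<^sub>R c)" for c :: complex
    using emeasure_lborel_ball_finite[of "0::complex" r] by (intro integrable_scaleR_left integrable_real_indicator) auto
  have F_le: "norm (F n z) \<le> indicator (ball 0 r) z * (norm (a n) * r ^ n)" for n z
    by (auto simp: F_def indicator_def norm_mult norm_power intro!: mult_left_mono power_mono)
  have F_int: "integrable lborel (F n)" for n
  proof (rule Bochner_Integration.integrable_bound[OF ball_int[of "of_real (norm (a n) * r ^ n)"]])
    show "F n \<in> borel_measurable lborel"
      unfolding F_def by (auto intro!: borel_measurable_continuous_on_indicator continuous_intros)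
    show "AE z in lborel. norm (F n z) \<le> norm (indicator (ball 0 r) z *\<^sub>R complex_of_real (norm (a n) * r ^ n))"
      using F_le[of n] \<open>0 < r\<close> by (intro always_eventually allI) (simp add: norm_mult norm_power)
  qed
  have F_int_le: "(LINT z|lborel. norm (F n z)) \<le> measure lborel (ball (0::complex) r) * (norm (a n) * r ^ n)" for n
  proof -
    have "(LINT z|lborel. norm (F n z)) \<le> (LINT z|lborel. indicator (ball (0::complex) r) z * (norm (a n) * r ^ n))"
      using F_int[of n] F_le[of n] emeasure_lborel_ball_finite[of "0::complex" r]
      by (intro integral_mono integrable_norm integrable_mult_left integrable_real_indicator) auto
    then show ?thesis
      by simp
  qed
  have F_sums: "(\<lambda>n. F n z) sums (indicator (ball 0 r) z *\<^sub>R h (w + z))" for z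
    using sums[of z] \<open>r < R\<close> by (auto simp: F_def indicator_def)
  have cont: "continuous_on (ball w r) h"
    using assms by (meson ball_subset_ball_iff holomorphic_on_imp_continuous_on holomorphic_on_subset order_less_imp_le subset_ball)
  have "(LINT z:ball w r|lborel. h z) = (LINT z|distr lborel borel ((+) w). indicator (ball w r) z *\<^sub>R h z)"
    by (simp add: set_lebesgue_integral_def lborel_distr_plus)
  also have "\<dots> = (LINT z|lborel. indicator (ball w r) (w + z) *\<^sub>R h (w + z))"
    by (subst integral_distr) (auto intro!: borel_measurable_continuous_on_indicator cont)
  also have "\<dots> = (LINT z|lborel. (\<Sum>n. F n z))"
    by (intro Bochner_Integration.integral_cong)
      (use F_sums in \<open>auto simp: sums_iff indicator_def dist_norm\<close>)
  also have "\<dots> = (\<Sum>n. integral\<^sup>L lborel (F n))"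
  proof (rule integral_suminf[OF F_int])
    show "AE z in lborel. summable (\<lambda>n. norm (F n z))"
    proof (intro always_eventually allI)
      fix z
      show "summable (\<lambda>n. norm (F n z))"
        by (rule summable_comparison_test'[OF summable_mult[OF summ, of "indicator (ball 0 r) z"], of 0])
          (use F_le[of _ z] in simp)
    qed
    show "summable (\<lambda>n. LINT z|lborel. norm (F n z))"
      by (rule summable_comparison_test'[OF summable_mult[OF summ, of "measure lborel (ball (0::complex) r)"], of 0])
        (use F_int_le in \<open>simp add: integral_nonneg\<close>)
  qed
  also have "(\<lambda>n. integral\<^sup>L lborel (F n)) = (\<lambda>n. if n = 0 then measure lborel (ball w r) * h w else 0)"
  proof
    fix n
    have "integral\<^sup>L lborel (F n) = (LINT z|lborel. a n * (indicator (ball 0 r) z *\<^sub>R z ^ n))"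
      unfolding F_def by simp
    also have "\<dots> = a n * (LINT z:ball 0 r|lborel. z ^ n)"
      unfolding set_lebesgue_integral_def by (rule integral_mult_right_zero)
    finally have "integral\<^sup>L lborel (F n) = a n * (LINT z:ball 0 r|lborel. z ^ n)" .
    moreover have "measure lborel (ball w r) = measure lborel (ball (0::complex) r)"
      using \<open>0 < r\<close> by (simp add: content_ball)
    moreover have "(LINT z:ball (0::complex) r|lborel. (1::complex)) = measure lborel (ball (0::complex) r)"
      using emeasure_lborel_ball_finite[of "0::complex" r] by (simp add: set_lebesgue_integral_def scaleR_conv_of_real)
    ultimately show "integral\<^sup>L lborel (F n) = (if n = 0 then measure lborel (ball w r) * h w else 0)"
      using integral_ball_power[of n r] by (auto simp: a_def)
  qed
  also have "(\<Sum>n. if n = 0 then measure lborel (ball w r) * h w else 0) = measure lborel (ball w r) * h w"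
    using suminf_finite[of "{0}" "\<lambda>n. if n = 0 then measure lborel (ball w r) * h w else 0"] by auto
  finally show ?thesis .
qed

text \<open>The square \<open>f\<^sup>2\<close> is holomorphic, so this is the mean value property of \<open>f\<^sup>2\<close>.\<close>

lemma norm_le_area_mean:
  fixes f :: "complex \<Rightarrow> complex"
  assumes R: "r < R" "ball w R \<subseteq> D" and "0 < r" and f: "f holomorphic_on D"
    and int: "set_integrable lborel D (\<lambda>z. (cmod (f z))\<^sup>2)"
  shows "measure lborel (ball w r) * (cmod (f w))\<^sup>2 \<le> (LINT z:D|lborel. (cmod (f z))\<^sup>2)"
proof -
  have sub: "ball w r \<subseteq> D"
    using R by (meson less_imp_le order_trans subset_ball)
  have int_r: "set_integrable lborel (ball w r) (\<lambda>z. (cmod (f z))\<^sup>2)"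
    using set_integrable_subset[OF int _ sub] by simp
  have "(\<lambda>z. (f z)\<^sup>2) holomorphic_on ball w R"
    using f R(2) by (intro holomorphic_intros) (auto intro: holomorphic_on_subset)
  then have "measure lborel (ball w r) * (f w)\<^sup>2 = (LINT z:ball w r|lborel. (f z)\<^sup>2)"
    using area_mean_value[of "\<lambda>z. (f z)\<^sup>2" w R r] R(1) \<open>0 < r\<close> by simp
  then have "measure lborel (ball w r) * (cmod (f w))\<^sup>2 = cmod (LINT z:ball w r|lborel. (f z)\<^sup>2)"
    by (metis abs_of_nonneg measure_nonneg norm_mult norm_of_real norm_power)
  also have "\<dots> \<le> (LINT z:ball w r|lborel. (cmod (f z))\<^sup>2)"
    unfolding set_lebesgue_integral_def
    by (rule order_trans[OF integral_norm_bound]) (simp add: norm_power)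
  also have "\<dots> \<le> (LINT z:D|lborel. (cmod (f z))\<^sup>2)"
    using int int_r sub unfolding set_integrable_def set_lebesgue_integral_def
    by (intro integral_mono) (auto simp: indicator_def)
  finally show ?thesis .
qed

section \<open>The Bergman space of a bounded open set\<close>

text \<open>For \<open>k > n\<close> the product has a zero factor because of truncated subtraction, so one formula covers
all \<open>k\<close>.\<close>

lemma higher_deriv_power_diff:
  "(deriv ^^ k) (\<lambda>z::complex. (z - w) ^ n) = (\<lambda>z. of_nat (\<Prod>i<k. n - i) * (z - w) ^ (n - k))"
proof (induction k)
  case (Suc k)
  have "deriv (\<lambda>z. of_nat (\<Prod>i<k. n - i) * (z - w) ^ (n - k)) z
      = of_nat (\<Prod>i<Suc k. n - i) * (z - w) ^ (n - Suc k)" for z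
  proof (rule DERIV_imp_deriv)
    have "((\<lambda>z. of_nat (\<Prod>i<k. n - i) * (z - w) ^ (n - k)) has_field_derivative
        of_nat (\<Prod>i<k. n - i) * (of_nat (n - k) * (z - w) ^ (n - k - Suc 0))) (at z)"
      by (auto intro!: derivative_eq_intros)
    then show "((\<lambda>z. of_nat (\<Prod>i<k. n - i) * (z - w) ^ (n - k)) has_field_derivative
        of_nat (\<Prod>i<Suc k. n - i) * (z - w) ^ (n - Suc k)) (at z)"
      by (simp add: mult.assoc)
  qed
  then have "deriv (\<lambda>z. of_nat (\<Prod>i<k. n - i) * (z - w) ^ (n - k))
      = (\<lambda>z. of_nat (\<Prod>i<Suc k. n - i) * (z - w) ^ (n - Suc k))"
    by (rule ext)
  then show ?case
    by (simp only: funpow.simps o_apply Suc.IH)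
qed simp

lemma higher_deriv_power_diff_at:
  "(deriv ^^ k) (\<lambda>z::complex. (z - w) ^ n) w = (if k = n then fact n else 0)"
proof -
  have "(\<Prod>i<n. n - i) = fact n"
    by (simp add: fact_prod_rev atLeast0LessThan)
  moreover have "(\<Prod>i<k. n - i) = 0" if "n < k"
    using that by (intro prod_zero) auto
  ultimately show ?thesis
    by (auto simp: higher_deriv_power_diff power_0_left of_nat_fact simp flip: of_nat_prod)
qed

definition bergman_sqnorm :: "complex set \<Rightarrow> (complex \<Rightarrow> complex) \<Rightarrow> real" where
  "bergman_sqnorm D f = (LINT z:D|lborel. (cmod (f z))\<^sup>2)"

text \<open>Boundedness puts the polynomials into the Bergman space; this is what makes the derivative functionals
nonzero and independent.\<close>

locale bounded_open =
  fixes D :: "complex set"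
  assumes open_D: "open D" and bounded_D: "bounded D"
begin

abbreviation "A2 \<equiv> bergman_space D"
abbreviation "ip \<equiv> bergman_inner D"
abbreviation "sqnorm \<equiv> bergman_sqnorm D"

lemma A2D: "f \<in> A2 \<Longrightarrow> f holomorphic_on D" "f \<in> A2 \<Longrightarrow> set_integrable lborel D (\<lambda>z. (cmod (f z))\<^sup>2)"
  by (simp_all add: bergman_space_def)

lemma measurable_on_D:
  fixes f :: "complex \<Rightarrow> 'b::real_normed_vector"
  assumes "continuous_on D f"
  shows "set_borel_measurable lborel D f"
  using borel_measurable_continuous_on_indicator[OF _ assms] open_D
  by (simp add: set_borel_measurable_def)

lemma A2_mult_integrable:
  assumes "f \<in> A2" "g \<in> A2"
  shows "set_integrable lborel D (\<lambda>z. f z * cnj (g z))"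
proof (rule set_integrable_bound)
  show "set_integrable lborel D (\<lambda>z. (cmod (f z))\<^sup>2 + (cmod (g z))\<^sup>2)"
    using assms by (intro set_integral_add A2D)
  show "set_borel_measurable lborel D (\<lambda>z. f z * cnj (g z))"
    using assms by (intro measurable_on_D continuous_intros holomorphic_on_imp_continuous_on A2D)
  show "AE z in lborel. z \<in> D \<longrightarrow> norm (f z * cnj (g z)) \<le> norm ((cmod (f z))\<^sup>2 + (cmod (g z))\<^sup>2)"
  proof (intro always_eventually allI impI)
    fix z
    have "2 * (cmod (f z) * cmod (g z)) \<le> (cmod (f z))\<^sup>2 + (cmod (g z))\<^sup>2"
      using sum_squares_bound[of "cmod (f z)" "cmod (g z)"] by (simp add: mult.assoc)
    moreover have "0 \<le> cmod (f z) * cmod (g z)"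
      by simp
    ultimately have "cmod (f z) * cmod (g z) \<le> (cmod (f z))\<^sup>2 + (cmod (g z))\<^sup>2"
      by linarith
    then show "norm (f z * cnj (g z)) \<le> norm ((cmod (f z))\<^sup>2 + (cmod (g z))\<^sup>2)"
      by (simp add: norm_mult)
  qed
qed

lemma ip_add_left:
  "f \<in> A2 \<Longrightarrow> g \<in> A2 \<Longrightarrow> h \<in> A2 \<Longrightarrow> ip (\<lambda>z. f z + g z) h = ip f h + ip g h"
  by (simp add: bergman_inner_def distrib_right A2_mult_integrable)

lemma ip_scale_left: "ip (\<lambda>z. c * f z) h = c * ip f h"
  by (simp add: bergman_inner_def mult.assoc)

lemma ip_cnj: "cnj (ip f g) = ip g f"
  by (simp add: bergman_inner_def set_lebesgue_integral_def mult.commute flip: Bochner_Integration.integral_cnj)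

lemma ip_add_right:
  "f \<in> A2 \<Longrightarrow> g \<in> A2 \<Longrightarrow> h \<in> A2 \<Longrightarrow> ip h (\<lambda>z. f z + g z) = ip h f + ip h g"
  by (subst (1 2 3) ip_cnj[symmetric]) (simp add: ip_add_left)

lemma ip_scale_right: "ip h (\<lambda>z. c * f z) = cnj c * ip h f"
  by (subst (1 2) ip_cnj[symmetric]) (simp add: ip_scale_left)

lemma ip_self: "ip f f = complex_of_real (sqnorm f)"
proof -
  have eq: "f z * cnj (f z) = complex_of_real ((cmod (f z))\<^sup>2)" for z
    by (rule complex_norm_square[symmetric])
  have "ip f f = (LINT z|lborel. complex_of_real (indicator D z *\<^sub>R (cmod (f z))\<^sup>2))"
    unfolding bergman_inner_def set_lebesgue_integral_def eq by (simp add: scaleR_conv_of_real)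
  also have "\<dots> = complex_of_real (sqnorm f)"
    unfolding bergman_sqnorm_def set_lebesgue_integral_def by (rule integral_complex_of_real)
  finally show ?thesis .
qed

lemma sqnorm_nonneg: "0 \<le> sqnorm f"
  by (simp add: bergman_sqnorm_def set_lebesgue_integral_def)

lemma A2_add:
  assumes "f \<in> A2" "g \<in> A2"
  shows "(\<lambda>z. f z + g z) \<in> A2"
proof -
  have "set_integrable lborel D (\<lambda>z. (cmod (f z + g z))\<^sup>2)"
  proof (rule set_integrable_bound)
    show "set_integrable lborel D (\<lambda>z. 2 * ((cmod (f z))\<^sup>2 + (cmod (g z))\<^sup>2))"
      using assms by (intro set_integrable_mult_right set_integral_add A2D)
    show "set_borel_measurable lborel D (\<lambda>z. (cmod (f z + g z))\<^sup>2)"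
      using assms by (intro measurable_on_D continuous_intros holomorphic_on_imp_continuous_on A2D)
    show "AE z in lborel. z \<in> D \<longrightarrow> norm ((cmod (f z + g z))\<^sup>2) \<le> norm (2 * ((cmod (f z))\<^sup>2 + (cmod (g z))\<^sup>2))"
    proof (intro always_eventually allI impI)
      fix z
      have "(cmod (f z + g z))\<^sup>2 \<le> (cmod (f z) + cmod (g z))\<^sup>2"
        by (intro power_mono norm_triangle_ineq) simp
      also have "\<dots> \<le> 2 * ((cmod (f z))\<^sup>2 + (cmod (g z))\<^sup>2)"
        using zero_le_power2[of "cmod (f z) - cmod (g z)"] by (simp add: power2_diff power2_sum)
      finally show "norm ((cmod (f z + g z))\<^sup>2) \<le> norm (2 * ((cmod (f z))\<^sup>2 + (cmod (g z))\<^sup>2))"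
        by simp
    qed
  qed
  then show ?thesis
    using assms by (auto simp: bergman_space_def intro: holomorphic_on_add)
qed

lemma A2_scale: "f \<in> A2 \<Longrightarrow> (\<lambda>z. c * f z) \<in> A2"
  by (auto simp: bergman_space_def norm_mult power_mult_distrib intro!: holomorphic_intros)

lemma power_diff_in_A2: "(\<lambda>z. (z - w) ^ n) \<in> A2"
proof -
  obtain B where B: "\<And>z. z \<in> D \<Longrightarrow> cmod z \<le> B"
    using bounded_D by (auto simp: bounded_iff)
  have fin: "emeasure lborel D < \<infinity>"
    using bounded_D by (rule emeasure_bounded_finite)
  have "integrable lborel (\<lambda>z. indicator D z *\<^sub>R (cmod ((z - w) ^ n))\<^sup>2)"
  proof (rule integrableI_bounded_set[of D _ _ "((B + cmod w) ^ n)\<^sup>2"])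
    show "(\<lambda>z. indicator D z *\<^sub>R (cmod ((z - w) ^ n))\<^sup>2) \<in> borel_measurable lborel"
      using open_D by (auto intro!: borel_measurable_continuous_on_indicator continuous_intros)
    show "AE z in lborel. z \<in> D \<longrightarrow> norm (indicator D z *\<^sub>R (cmod ((z - w) ^ n))\<^sup>2) \<le> ((B + cmod w) ^ n)\<^sup>2"
    proof (intro always_eventually allI impI)
      fix z assume "z \<in> D"
      then have "cmod (z - w) \<le> B + cmod w"
        using B[of z] norm_triangle_ineq4[of z w] by simp
      then show "norm (indicator D z *\<^sub>R (cmod ((z - w) ^ n))\<^sup>2) \<le> ((B + cmod w) ^ n)\<^sup>2"
        using \<open>z \<in> D\<close> by (simp add: norm_power power_mono)
    qed
  qed (use open_D fin in auto)
  then show ?thesis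
    by (auto simp: bergman_space_def set_integrable_def intro!: holomorphic_intros)
qed

text \<open>The disc of radius \<open>r / 2\<close> leaves the room that the area mean value property asks for, and \<open>\<pi> \<ge> 1\<close>
removes the area factor.\<close>

lemma point_bound:
  assumes "f \<in> A2" "0 < r" "ball w r \<subseteq> D"
  shows "cmod (f w) \<le> sqrt (sqnorm f) * (2 / r)"
proof -
  have "measure lborel (ball w (r / 2)) * (cmod (f w))\<^sup>2 \<le> sqnorm f"
    unfolding bergman_sqnorm_def using assms by (intro norm_le_area_mean[of _ r] A2D) auto
  then have "pi * ((r / 2)\<^sup>2 * (cmod (f w))\<^sup>2) \<le> sqnorm f"
    using assms(2) by (simp add: content_ball unit_ball_vol_2 mult.assoc power_divide)
  moreover have "1 * ((r / 2)\<^sup>2 * (cmod (f w))\<^sup>2) \<le> pi * ((r / 2)\<^sup>2 * (cmod (f w))\<^sup>2)"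
    using pi_gt3 by (intro mult_right_mono) auto
  moreover have "(cmod (f w) * (r / 2))\<^sup>2 = 1 * ((r / 2)\<^sup>2 * (cmod (f w))\<^sup>2)"
    by (simp add: power2_eq_square)
  ultimately have "(cmod (f w) * (r / 2))\<^sup>2 \<le> sqnorm f"
    by linarith
  then have "cmod (f w) * (r / 2) \<le> sqrt (sqnorm f)"
    by (rule real_le_rsqrt)
  then show ?thesis
    using assms(2) by (simp add: field_simps)
qed

text \<open>Point evaluations are bounded uniformly near \<open>w\<close>, and Cauchy's inequality passes this on to
derivatives. One third of the radius \<open>R\<close> is spent on the position of \<open>z\<close>, one on the circle around \<open>z\<close> in
Cauchy's inequality, and one on the disc around a point of that circle.\<close>

lemma higher_deriv_bound:
  assumes "w \<in> D"
  shows "\<exists>\<delta>>0. \<exists>C\<ge>0. ball w \<delta> \<subseteq> D \<and>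
    (\<forall>f\<in>A2. \<forall>z\<in>ball w \<delta>. cmod ((deriv ^^ k) f z) \<le> C * sqrt (sqnorm f))"
proof -
  obtain R where R: "0 < R" "ball w R \<subseteq> D"
    using assms open_D by (auto simp: open_contains_ball)
  define C where "C = fact k * (2 / (R / 3)) / (R / 3) ^ k"
  have "cmod ((deriv ^^ k) f z) \<le> C * sqrt (sqnorm f)" if f: "f \<in> A2" and z: "z \<in> ball w (R / 3)" for f z
  proof -
    have sub: "ball x (R / 3) \<subseteq> D" if "x \<in> cball z (R / 3)" for x
    proof
      fix y assume "y \<in> ball x (R / 3)"
      then have "dist w y < R"
        using z that dist_triangle[of w y z] dist_triangle[of z y x] by simp
      then show "y \<in> D"
        using R(2) by auto
    qed
    then have "x \<in> D" if "x \<in> cball z (R / 3)" for x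
      using that R(1) by (meson centre_in_ball divide_pos_pos subsetD zero_less_numeral)
    then have "f holomorphic_on cball z (R / 3)"
      using A2D(1)[OF f] by (meson holomorphic_on_subset subsetI)
    then have "cmod ((deriv ^^ k) f z) \<le> fact k * (sqrt (sqnorm f) * (2 / (R / 3))) / (R / 3) ^ k"
      using point_bound[OF f, of "R / 3"] sub R(1)
      by (intro Cauchy_inequality)
        (auto simp: dist_norm intro: holomorphic_on_subset holomorphic_on_imp_continuous_on)
    then show ?thesis
      by (simp add: C_def mult_ac)
  qed
  moreover have "ball w (R / 3) \<subseteq> D" "0 \<le> C"
    using R by (auto simp: C_def)
  ultimately show ?thesis
    using R(1) by (intro exI[of _ "R / 3"] exI[of _ C]) auto
qed

section \<open>Representers of the derivative functionals\<close>

lemma nn_integral_sqnorm: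
  assumes "f \<in> A2"
  shows "(\<integral>\<^sup>+z. ennreal (indicator D z *\<^sub>R (cmod (f z))\<^sup>2) \<partial>lborel) = ennreal (sqnorm f)"
  using A2D(2)[OF assms] unfolding set_integrable_def bergman_sqnorm_def set_lebesgue_integral_def
  by (intro nn_integral_eq_integral) auto

text \<open>Fatou's lemma: the norm is lower semicontinuous under pointwise convergence.\<close>

lemma pointwise_limit_in_A2:
  assumes F: "\<And>n. F n \<in> A2" "\<And>n. sqnorm (F n) \<le> c n" and c: "c \<longlonglongrightarrow> m" "0 \<le> m"
    and g: "g holomorphic_on D" and lim: "\<And>z. z \<in> D \<Longrightarrow> (\<lambda>n. F n z) \<longlonglongrightarrow> g z"
  shows "g \<in> A2" "sqnorm g \<le> m"
proof -
  define u where "u n z = ennreal (indicator D z *\<^sub>R (cmod (F n z))\<^sup>2)" for n z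
  define v where "v z = indicator D z *\<^sub>R (cmod (g z))\<^sup>2" for z
  have v_meas: "v \<in> borel_measurable lborel"
    unfolding v_def set_borel_measurable_def[symmetric]
    by (intro measurable_on_D continuous_intros holomorphic_on_imp_continuous_on g)
  have u_meas: "u n \<in> borel_measurable lborel" for n
    using A2D(2)[OF F(1)[of n]] unfolding u_def set_integrable_def
    by (intro measurable_compose[OF _ measurable_ennreal]) auto
  have "ennreal (v z) = liminf (\<lambda>n. u n z)" for z
  proof -
    have "(\<lambda>n. indicator D z *\<^sub>R (cmod (F n z))\<^sup>2) \<longlonglongrightarrow> v z"
      using lim[of z] unfolding v_def by (cases "z \<in> D") (auto intro!: tendsto_intros)
    then have "(\<lambda>n. u n z) \<longlonglongrightarrow> ennreal (v z)"
      unfolding u_def by (rule tendsto_ennrealI)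
    then show ?thesis
      by (metis lim_imp_Liminf trivial_limit_sequentially)
  qed
  then have "(\<integral>\<^sup>+z. ennreal (v z) \<partial>lborel) = (\<integral>\<^sup>+z. liminf (\<lambda>n. u n z) \<partial>lborel)"
    by simp
  also have "\<dots> \<le> liminf (\<lambda>n. \<integral>\<^sup>+z. u n z \<partial>lborel)"
    by (rule nn_integral_liminf) (rule u_meas)
  also have "\<dots> = liminf (\<lambda>n. ennreal (sqnorm (F n)))"
    unfolding u_def using nn_integral_sqnorm[OF F(1)] by simp
  also have "\<dots> \<le> liminf (\<lambda>n. ennreal (c n))"
    using F(2) by (intro Liminf_mono always_eventually allI ennreal_leI)
  also have "\<dots> = ennreal m"
    using c(1) by (intro lim_imp_Liminf tendsto_ennrealI) auto
  finally have le: "(\<integral>\<^sup>+z. ennreal (v z) \<partial>lborel) \<le> ennreal m" .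
  have int: "integrable lborel v"
    using v_meas le by (intro integrableI_nonneg) (auto simp: v_def intro: le_less_trans)
  then show "g \<in> A2"
    using g by (simp add: bergman_space_def set_integrable_def v_def[abs_def])
  from nn_integral_sqnorm[OF this] le have "ennreal (sqnorm g) \<le> ennreal m"
    by (simp add: v_def)
  then show "sqnorm g \<le> m"
    using c(2) by simp
qed

lemma higher_deriv_A2_linear:
  assumes "w \<in> D" "f \<in> A2" "g \<in> A2"
  shows "(deriv ^^ k) (\<lambda>z. f z + c * g z) w = (deriv ^^ k) f w + c * (deriv ^^ k) g w"
  using higher_deriv_add[OF A2D(1)[OF assms(2)] A2D(1)[OF A2_scale[OF assms(3)]] open_D assms(1), of k c]
    higher_deriv_cmult[OF A2D(1)[OF assms(3)] assms(1) open_D, of k c] by simp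

lemma sqnorm_add_scale:
  assumes "f \<in> A2" "g \<in> A2"
  shows "sqnorm (\<lambda>z. f z + c * g z) = sqnorm f + 2 * Re (c * ip g f) + (cmod c)\<^sup>2 * sqnorm g"
proof -
  let ?h = "\<lambda>z. f z + c * g z"
  have "complex_of_real (sqnorm ?h) = ip f f + cnj c * ip f g + c * (ip g f + cnj c * ip g g)"
    using assms by (simp add: ip_self[symmetric] ip_add_left ip_add_right ip_scale_left ip_scale_right A2_scale A2_add)
  also have "cnj c * ip f g = cnj (c * ip g f)"
    by (simp add: ip_cnj)
  also have "c * (ip g f + cnj c * ip g g) = c * ip g f + (complex_of_real ((cmod c)\<^sup>2)) * ip g g"
    by (subst complex_norm_square) (simp add: algebra_simps)
  also have "ip f f + cnj (c * ip g f) + (c * ip g f + (complex_of_real ((cmod c)\<^sup>2)) * ip g g)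
      = complex_of_real (sqnorm f + 2 * Re (c * ip g f) + (cmod c)\<^sup>2 * sqnorm g)"
    by (simp add: ip_self complex_eq_iff)
  finally show ?thesis
    by (simp only: of_real_eq_iff)
qed

text \<open>Moving from \<open>g\<close> a short way along \<open>h\<close> with the phase of \<open>- cnj \<langle>h, g\<rangle>\<close> would lower the norm.\<close>

lemma minimal_imp_orthogonal:
  assumes "g \<in> A2" "h \<in> A2" and min: "\<And>c. sqnorm g \<le> sqnorm (\<lambda>z. g z + c * h z)"
  shows "ip h g = 0"
proof (rule ccontr)
  assume nz: "ip h g \<noteq> 0"
  \<comment> \<open>any step with \<open>s * sqnorm h < 2\<close> works; the summand 1 avoids division by zero\<close>
  define s where "s = 1 / (sqnorm h + 1)"
  have s: "0 < s" "s * sqnorm h < 1"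
    using sqnorm_nonneg[of h] by (auto simp: s_def field_simps)
  define c where "c = - (complex_of_real s * cnj (ip h g))"
  have "c * ip h g = - complex_of_real (s * (cmod (ip h g))\<^sup>2)"
    unfolding c_def by (simp only: of_real_mult complex_norm_square) (simp add: algebra_simps)
  moreover have "cmod c = s * cmod (ip h g)"
    using s(1) by (simp add: c_def norm_mult)
  ultimately have "0 \<le> - 2 * (s * (cmod (ip h g))\<^sup>2) + (s * cmod (ip h g))\<^sup>2 * sqnorm h"
    using min[of c] sqnorm_add_scale[OF assms(1,2), of c] by simp
  also have "\<dots> = (s * (cmod (ip h g))\<^sup>2) * (s * sqnorm h - 2)"
    by (simp add: power2_eq_square algebra_simps)
  also have "\<dots> < 0"
    using s nz by (intro mult_pos_neg) auto
  finally show False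
    by simp
qed

text \<open>The Riesz representation theorem for the functional \<open>L f = f\<^sup>(\<^sup>k\<^sup>)(w)\<close>. A minimizing sequence for the norm
on \<open>{f. L f = 1}\<close> is locally bounded, so by Montel's theorem a subsequence converges locally
uniformly; its limit \<open>g\<close> still satisfies \<open>L g = 1\<close> and has minimal norm. Hence \<open>g\<close> is orthogonal to the kernel
of \<open>L\<close>, and \<open>g / sqnorm g\<close> represents \<open>L\<close>.\<close>

lemma derivative_representer_exists:
  assumes w: "w \<in> D"
  shows "\<exists>e\<in>A2. \<forall>f\<in>A2. (deriv ^^ k) f w = ip f e"
proof -
  define L where "L f = (deriv ^^ k) f w" for f
  define \<F> where "\<F> = {f \<in> A2. L f = 1}"
  define p where "p = (\<lambda>z. 1 / fact k * (z - w) ^ k)"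
  have "p \<in> A2"
    unfolding p_def by (rule A2_scale[OF power_diff_in_A2])
  moreover have "L p = 1 / fact k * (deriv ^^ k) (\<lambda>z. (z - w) ^ k) w"
    unfolding L_def p_def by (rule higher_deriv_cmult[where A = UNIV]) (auto intro!: holomorphic_intros)
  ultimately have "p \<in> \<F>"
    by (simp add: \<F>_def higher_deriv_power_diff_at)
  define m where "m = Inf (sqnorm ` \<F>)"
  have bdd: "bdd_below (sqnorm ` \<F>)"
    by (rule bdd_belowI[of _ 0]) (auto simp: sqnorm_nonneg)
  have m_le: "m \<le> sqnorm f" if "f \<in> \<F>" for f
    unfolding m_def using that bdd by (intro cInf_lower) auto
  have m0: "0 \<le> m"
    unfolding m_def using \<open>p \<in> \<F>\<close> by (intro cInf_greatest) (auto simp: sqnorm_nonneg)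
  have "\<exists>f\<in>\<F>. sqnorm f \<le> m + 1 / Suc n" for n
  proof -
    have "m < m + 1 / Suc n"
      by simp
    then have "\<exists>x\<in>sqnorm ` \<F>. x < m + 1 / Suc n"
      unfolding m_def using \<open>p \<in> \<F>\<close> by (intro cInf_lessD) auto
    then show ?thesis
      by (auto intro: less_imp_le)
  qed
  then obtain F where F: "\<And>n. F n \<in> \<F>" "\<And>n. sqnorm (F n) \<le> m + 1 / Suc n"
    by metis
  obtain g r where g: "g holomorphic_on D" and r: "strict_mono r"
    and lim: "\<And>z. z \<in> D \<Longrightarrow> (\<lambda>n. F (r n) z) \<longlonglongrightarrow> g z"
    and ulim: "\<And>K. compact K \<Longrightarrow> K \<subseteq> D \<Longrightarrow> uniform_limit K (F \<circ> r) g sequentially"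
  proof (rule Montel[OF open_D, of "{f \<in> A2. sqnorm f \<le> m + 1}" F])
    show "h holomorphic_on D" if "h \<in> {f \<in> A2. sqnorm f \<le> m + 1}" for h
      using that A2D by auto
    show "\<exists>B. \<forall>h\<in>{f \<in> A2. sqnorm f \<le> m + 1}. \<forall>z\<in>K. norm (h z) \<le> B" if K: "compact K" "K \<subseteq> D" for K
    proof -
      obtain e where e: "e > 0" "(\<Union>x\<in>K. ball x e) \<subseteq> D"
        using compact_subset_open_imp_ball_epsilon_subset[OF K(1) open_D K(2)] .
      have "norm (h z) \<le> sqrt (m + 1) * (2 / e)" if "h \<in> A2" "sqnorm h \<le> m + 1" "z \<in> K" for h z
      proof -
        have "norm (h z) \<le> sqrt (sqnorm h) * (2 / e)"
          using that e by (intro point_bound) auto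
        also have "\<dots> \<le> sqrt (m + 1) * (2 / e)"
          using that e by (intro mult_right_mono) auto
        finally show ?thesis .
      qed
      then show ?thesis
        by blast
    qed
    show "range F \<subseteq> {f \<in> A2. sqnorm f \<le> m + 1}"
    proof clarify
      fix n
      have "m + 1 / Suc n \<le> m + 1"
        by simp
      then show "F n \<in> A2 \<and> sqnorm (F n) \<le> m + 1"
        using F(1)[of n] order_trans[OF F(2)[of n]] by (auto simp: \<F>_def)
    qed
  qed blast
  have Fr: "F (r n) \<in> A2" "L (F (r n)) = 1" for n
    using F(1)[of "r n"] by (auto simp: \<F>_def)
  have "(\<lambda>n. m + 1 / Suc n) \<longlonglongrightarrow> m + 0"
    by (intro tendsto_add tendsto_const LIMSEQ_Suc[OF lim_1_over_n])
  then have cr: "(\<lambda>n. m + 1 / Suc (r n)) \<longlonglongrightarrow> m"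
    using LIMSEQ_subseq_LIMSEQ[OF _ r] by (fastforce simp: o_def)
  have gA: "g \<in> A2" and gm: "sqnorm g \<le> m"
    using pointwise_limit_in_A2[of "\<lambda>n. F (r n)" "\<lambda>n. m + 1 / Suc (r n)" m g] Fr(1) F(2) cr m0 g lim
    by auto
  have Lg: "L g = 1"
  proof -
    obtain d where d: "d > 0" "cball w d \<subseteq> D"
      using w open_D by (auto simp: open_contains_cball)
    have "((\<lambda>n. (deriv ^^ k) (F (r n)) w) \<longlongrightarrow> (deriv ^^ k) g w) sequentially"
    proof (rule higher_deriv_complex_uniform_limit[where A = "ball w d"])
      show "uniform_limit (ball w d) (\<lambda>n. F (r n)) g sequentially"
        using uniform_limit_on_subset[OF ulim[OF compact_cball d(2)] ball_subset_cball] by (simp add: o_def)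
      show "\<forall>\<^sub>F n in sequentially. F (r n) holomorphic_on ball w d"
        using d(2) ball_subset_cball by (intro always_eventually allI holomorphic_on_subset[OF A2D(1)[OF Fr(1)]]) blast
    qed (use d in auto)
    then have "(\<lambda>n. 1) \<longlonglongrightarrow> L g"
      using Fr(2) by (simp add: L_def)
    then show ?thesis
      using LIMSEQ_unique[OF tendsto_const] by metis
  qed
  have orth: "ip h g = 0" if h: "h \<in> A2" "L h = 0" for h
  proof (rule minimal_imp_orthogonal[OF gA h(1)])
    fix c
    have "(\<lambda>z. g z + c * h z) \<in> \<F>"
      using gA h Lg w by (auto simp: \<F>_def L_def higher_deriv_A2_linear intro!: A2_add A2_scale)
    then show "sqnorm g \<le> sqnorm (\<lambda>z. g z + c * h z)"
      using gm m_le by (meson order_trans)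
  qed
  have pos: "sqnorm g \<noteq> 0"
  proof
    assume "sqnorm g = 0"
    obtain \<delta> C where "0 < \<delta>"
      and "\<forall>f\<in>A2. \<forall>z\<in>ball w \<delta>. cmod ((deriv ^^ k) f z) \<le> C * sqrt (sqnorm f)"
      using higher_deriv_bound[OF w, of k] by blast
    then have "cmod ((deriv ^^ k) g w) \<le> C * sqrt (sqnorm g)"
      using gA by simp
    with \<open>sqnorm g = 0\<close> Lg show False
      by (simp add: L_def)
  qed
  define e where "e = (\<lambda>z. complex_of_real (1 / sqnorm g) * g z)"
  have "L f = ip f e" if f: "f \<in> A2" for f
  proof -
    have "(\<lambda>z. f z + (- L f) * g z) \<in> A2"
      using f gA by (intro A2_add A2_scale)
    moreover have "L (\<lambda>z. f z + (- L f) * g z) = 0"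
      using higher_deriv_A2_linear[OF w f gA, of k "- L f"] Lg by (simp add: L_def)
    ultimately have "ip (\<lambda>z. f z + (- L f) * g z) g = 0"
      by (rule orth)
    moreover have "ip (\<lambda>z. f z + (- L f) * g z) g = ip f g + (- L f) * ip g g"
      using f gA by (subst ip_add_left) (auto intro: A2_scale simp only: ip_scale_left)
    ultimately have "ip f g = L f * complex_of_real (sqnorm g)"
      by (simp add: ip_self)
    moreover have "ip f e = cnj (complex_of_real (1 / sqnorm g)) * ip f g"
      unfolding e_def by (rule ip_scale_right)
    ultimately show ?thesis
      using pos by simp
  qed
  moreover have "e \<in> A2"
    unfolding e_def by (rule A2_scale[OF gA])
  ultimately show ?thesis
    unfolding L_def by blast
qed

section \<open>Derivatives of the Bergman kernel as inner products\<close>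

definition rep :: "nat \<Rightarrow> complex \<Rightarrow> complex \<Rightarrow> complex" where
  "rep k w = (SOME e. e \<in> A2 \<and> (\<forall>f\<in>A2. (deriv ^^ k) f w = ip f e))"

lemma
  assumes "w \<in> D"
  shows rep_in_A2: "rep k w \<in> A2"
    and ip_rep: "f \<in> A2 \<Longrightarrow> ip f (rep k w) = (deriv ^^ k) f w"
proof -
  have "\<exists>e. e \<in> A2 \<and> (\<forall>f\<in>A2. (deriv ^^ k) f w = ip f e)"
    using derivative_representer_exists[OF assms, of k] by blast
  from someI_ex[OF this]
  have "rep k w \<in> A2 \<and> (\<forall>f\<in>A2. (deriv ^^ k) f w = ip f (rep k w))"
    unfolding rep_def .
  then show "rep k w \<in> A2" "f \<in> A2 \<Longrightarrow> ip f (rep k w) = (deriv ^^ k) f w"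
    by simp_all
qed

text \<open>The arguments are crossed, with \<open>z\<close> in the second slot of the inner product, so that \<open>jet j k\<close> is holomorphic
in \<open>z\<close> and antiholomorphic in \<open>w\<close>. It is the derivative of order \<open>j\<close> in \<open>z\<close> and \<open>k\<close> in the conjugate of \<open>w\<close>
of the Bergman kernel.\<close>

definition jet :: "nat \<Rightarrow> nat \<Rightarrow> complex \<Rightarrow> complex \<Rightarrow> complex" where
  "jet j k z w = ip (rep k w) (rep j z)"

lemma cnj_jet: "cnj (jet j k z w) = jet k j w z"
  by (simp add: jet_def ip_cnj)

lemma jet_eq_deriv: "z \<in> D \<Longrightarrow> w \<in> D \<Longrightarrow> jet j k z w = (deriv ^^ j) (rep k w) z"
  by (simp add: jet_def ip_rep rep_in_A2)

lemma jet_has_field_derivative: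
  assumes "z \<in> D" "w \<in> D"
  shows "((\<lambda>z. jet j k z w) has_field_derivative jet (Suc j) k z w) (at z)"
proof (rule has_field_derivative_transform_within_open[OF _ open_D assms(1)])
  show "((deriv ^^ j) (rep k w) has_field_derivative jet (Suc j) k z w) (at z)"
    unfolding jet_eq_deriv[OF assms]
    by (rule has_field_derivative_higher_deriv[OF A2D(1)[OF rep_in_A2[OF assms(2)]] open_D assms(1)])
qed (simp add: jet_eq_deriv assms)

lemma jet_has_derivative_snd:
  assumes "z \<in> D" "w \<in> D"
  shows "((\<lambda>w. jet j k z w) has_derivative (\<lambda>v. jet j (Suc k) z w * cnj v)) (at w)"
proof -
  have "((\<lambda>w. cnj (jet k j w z)) has_derivative (\<lambda>v. cnj (jet (Suc k) j w z * v))) (at w)"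
    using jet_has_field_derivative[OF assms(2,1), of k j]
    unfolding has_field_derivative_def by (rule has_derivative_cnj)
  then show ?thesis
    by (simp add: cnj_jet)
qed

text \<open>The representer of a functional of norm at most \<open>C\<close> has norm at most \<open>C\<close>, as one sees by applying the
functional to its own representer.\<close>

lemma jet_locally_bounded:
  assumes "p \<in> D"
  shows "\<exists>\<delta>>0. \<exists>C. ball p \<delta> \<subseteq> D \<and> (\<forall>z\<in>ball p \<delta>. \<forall>w\<in>ball p \<delta>. cmod (jet j k z w) \<le> C)"
proof -
  obtain d1 C1 where 1: "0 < d1" "ball p d1 \<subseteq> D" "0 \<le> C1"
    "\<And>f z. f \<in> A2 \<Longrightarrow> z \<in> ball p d1 \<Longrightarrow> cmod ((deriv ^^ j) f z) \<le> C1 * sqrt (sqnorm f)"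
    using higher_deriv_bound[OF assms, of j] by blast
  obtain d2 C2 where 2: "0 < d2" "ball p d2 \<subseteq> D" "0 \<le> C2"
    "\<And>f z. f \<in> A2 \<Longrightarrow> z \<in> ball p d2 \<Longrightarrow> cmod ((deriv ^^ k) f z) \<le> C2 * sqrt (sqnorm f)"
    using higher_deriv_bound[OF assms, of k] by blast
  have bound: "cmod (jet j k z w) \<le> C1 * C2" if "z \<in> ball p (min d1 d2)" "w \<in> ball p (min d1 d2)" for z w
  proof -
    have zw: "z \<in> D" "z \<in> ball p d1" "w \<in> D" "w \<in> ball p d2"
      using that 1(2) 2(2) by auto
    let ?N = "sqrt (sqnorm (rep k w))"
    have "complex_of_real (sqnorm (rep k w)) = (deriv ^^ k) (rep k w) w"
      by (simp add: ip_rep rep_in_A2 zw flip: ip_self)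
    then have "cmod ((deriv ^^ k) (rep k w) w) = sqnorm (rep k w)"
      using sqnorm_nonneg[of "rep k w"] by (metis abs_of_nonneg norm_of_real)
    then have "sqnorm (rep k w) \<le> C2 * ?N"
      using 2(4)[OF rep_in_A2[OF zw(3), of k] zw(4)] by simp
    then have "?N * ?N \<le> C2 * ?N"
      using sqnorm_nonneg by simp
    moreover have "0 \<le> ?N"
      using sqnorm_nonneg by simp
    ultimately have "?N \<le> C2"
      using 2(3) mult_right_le_imp_le[of ?N ?N C2] by (cases "?N = 0") linarith+
    then have "C1 * ?N \<le> C1 * C2"
      using 1(3) by (rule mult_left_mono)
    then show ?thesis
      using 1(4)[OF rep_in_A2[OF zw(3), of k] zw(2)] by (simp add: jet_eq_deriv zw)
  qed
  show ?thesis
    using 1(1,2) 2(1) bound by (intro exI[of _ "min d1 d2"] exI[of _ "C1 * C2"] conjI ballI) auto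
qed

text \<open>Joint continuity from separate continuity: the boundedness of the next jet makes \<open>jet j k\<close> Lipschitz in the
first variable, uniformly in the second.\<close>

lemma jet_tendsto:
  assumes p: "p \<in> D"
  shows "((\<lambda>x. jet j k (snd x) (fst x)) \<longlongrightarrow> jet j k p p) (at (p, p))"
proof -
  obtain \<delta> C where \<delta>: "0 < \<delta>" "ball p \<delta> \<subseteq> D"
    and C: "\<forall>z\<in>ball p \<delta>. \<forall>w\<in>ball p \<delta>. cmod (jet (Suc j) k z w) \<le> C"
    using jet_locally_bounded[OF p, of "Suc j" k] by blast
  have lip: "cmod (jet j k z w - jet j k p w) \<le> C * cmod (z - p)" if "z \<in> ball p \<delta>" "w \<in> ball p \<delta>" for z w
  proof (rule field_differentiable_bound[of "ball p \<delta>" "\<lambda>z. jet j k z w" "\<lambda>z. jet (Suc j) k z w"])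
    fix y assume "y \<in> ball p \<delta>"
    then have "y \<in> D" "w \<in> D"
      using that(2) \<delta>(2) by auto
    then show "((\<lambda>z. jet j k z w) has_field_derivative jet (Suc j) k y w) (at y within ball p \<delta>)"
      by (rule has_field_derivative_at_within[OF jet_has_field_derivative])
    show "cmod (jet (Suc j) k y w) \<le> C"
      using \<open>y \<in> ball p \<delta>\<close> that(2) C by blast
  qed (use that \<delta> in auto)
  have ev: "\<forall>\<^sub>F x in at (p, p). x \<in> ball p \<delta> \<times> ball p \<delta>"
    using \<delta>(1) by (intro eventually_at_in_open' open_Times) auto
  have "((\<lambda>x. jet j k (snd x) (fst x) - jet j k p (fst x)) \<longlongrightarrow> 0) (at (p, p))"
  proof (rule Lim_null_comparison)
    show "\<forall>\<^sub>F x in at (p, p). norm (jet j k (snd x) (fst x) - jet j k p (fst x)) \<le> C * cmod (snd x - p)"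
      using ev by eventually_elim (auto intro!: lip)
    have "((\<lambda>x. C * cmod (snd x - p)) \<longlongrightarrow> C * cmod (snd (p, p) - p)) (at (p, p))"
      by (intro tendsto_intros)
    then show "((\<lambda>x. C * cmod (snd x - p)) \<longlongrightarrow> 0) (at (p, p))"
      by simp
  qed
  moreover have "((\<lambda>x. jet j k p (fst x)) \<longlongrightarrow> jet j k p (fst (p, p))) (at (p, p))"
  proof (rule isCont_tendsto_compose[of _ "jet j k p"])
    show "isCont (jet j k p) (fst (p, p))"
      using has_derivative_continuous[OF jet_has_derivative_snd[OF p p]] by simp
  qed (rule tendsto_fst[OF tendsto_ident_at])
  ultimately have "((\<lambda>x. (jet j k (snd x) (fst x) - jet j k p (fst x)) + jet j k p (fst x))
      \<longlongrightarrow> 0 + jet j k p (fst (p, p))) (at (p, p))"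
    by (rule tendsto_add)
  then show ?thesis
    by simp
qed

text \<open>Total differentiability in the pair of variables asks for joint continuity of one partial derivative
only; the partial derivative in \<open>z\<close> is itself a jet.\<close>

lemma jet_has_wirtinger:
  assumes p: "p \<in> D"
  shows "has_wirtinger (\<lambda>z. jet j k z z) (jet (Suc j) k p p) (jet j (Suc k) p p) p"
proof -
  obtain \<delta> where \<delta>: "0 < \<delta>" "ball p \<delta> \<subseteq> D"
    using p open_D by (auto simp: open_contains_ball)
  let ?B = "ball p \<delta>"
  have "((\<lambda>(w, z). jet j k z w) has_derivative
      (\<lambda>(s, t). jet j (Suc k) p p * cnj s + blinfun_mult_right (jet (Suc j) k p p) t)) (at (p, p) within ?B \<times> ?B)"
  proof (rule has_derivative_partialsI[where fy = "\<lambda>w z. blinfun_mult_right (jet (Suc j) k z w)"])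
    show "((\<lambda>w. jet j k p w) has_derivative (\<lambda>s. jet j (Suc k) p p * cnj s)) (at p within ?B)"
      by (rule has_derivative_at_withinI[OF jet_has_derivative_snd[OF p p]])
    show "((\<lambda>z. jet j k z w) has_derivative blinfun_apply (blinfun_mult_right (jet (Suc j) k z w))) (at z within ?B)"
      if "w \<in> ?B" "z \<in> ?B" for w z
    proof -
      have "z \<in> D" "w \<in> D"
        using that \<delta>(2) by auto
      from has_derivative_at_withinI[OF jet_has_field_derivative[OF this, unfolded has_field_derivative_def]]
      show ?thesis
        by (simp add: blinfun_mult_right.rep_eq)
    qed
    have "((\<lambda>x. jet (Suc j) k (snd x) (fst x)) \<longlongrightarrow> jet (Suc j) k p p) (at (p, p) within ?B \<times> ?B)"
      using jet_tendsto[OF p] by (rule tendsto_within_subset) simp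
    then have "((\<lambda>x. blinfun_mult_right (jet (Suc j) k (snd x) (fst x))) \<longlongrightarrow> blinfun_mult_right (jet (Suc j) k p p))
        (at (p, p) within ?B \<times> ?B)"
      by (rule bounded_linear.tendsto[OF bounded_linear_blinfun_mult_right])
    then show "continuous (at (p, p) within ?B \<times> ?B) (\<lambda>(w, z). blinfun_mult_right (jet (Suc j) k z w))"
      by (simp add: continuous_within case_prod_unfold)
  qed (use \<delta> in auto)
  then have "((\<lambda>(w, z). jet j k z w) has_derivative
      (\<lambda>(s, t). jet j (Suc k) p p * cnj s + jet (Suc j) k p p * t)) (at (p, p))"
    using \<delta>(1) by (simp add: at_within_open[OF _ open_Times] blinfun_mult_right.rep_eq)
  from has_derivative_compose[OF has_derivative_Pair[OF has_derivative_ident has_derivative_ident], OF this]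
  show ?thesis
    by (simp add: has_wirtinger_def add.commute)
qed

text \<open>The reproducing property of any kernel \<open>K'\<close>, applied to \<open>e\<^sub>0(z)\<close>, determines \<open>K' z w\<close>, so the definite
description has a unique witness.\<close>

lemma bergman_kernel_eq_jet:
  assumes "z \<in> D" "w \<in> D"
  shows "bergman_kernel D z w = jet 0 0 z w"
proof -
  define K where "K z w = (if z \<in> D \<and> w \<in> D then jet 0 0 z w else 0)" for z w
  have slice: "(\<lambda>z. K z w) \<in> A2 \<and> (\<forall>f\<in>A2. f w = ip f (\<lambda>z. K z w))" if w: "w \<in> D" for w
  proof -
    have eq: "K z w = rep 0 w z" if "z \<in> D" for z
      using that w by (simp add: K_def jet_eq_deriv)
    have "(\<lambda>z. K z w) \<in> A2"
      using rep_in_A2[OF w, of 0]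
      by (simp add: bergman_space_def eq cong: holomorphic_cong set_integrable_cong)
    moreover have "ip f (\<lambda>z. K z w) = ip f (rep 0 w)" for f
      using open_D unfolding bergman_inner_def by (intro set_lebesgue_integral_cong) (auto simp: eq)
    ultimately show ?thesis
      by (simp add: ip_rep w)
  qed
  have "bergman_kernel D = K"
    unfolding bergman_kernel_def
  proof (rule the_equality)
    show "is_reproducing_kernel D K \<and> (\<forall>z w. z \<notin> D \<or> w \<notin> D \<longrightarrow> K z w = 0)"
      using slice by (auto simp: is_reproducing_kernel_def K_def)
    fix K' assume K': "is_reproducing_kernel D K' \<and> (\<forall>z w. z \<notin> D \<or> w \<notin> D \<longrightarrow> K' z w = 0)"
    have "K' z w = K z w" for z w
    proof (cases "z \<in> D \<and> w \<in> D")
      case True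
      have A: "(\<lambda>z. K' z w) \<in> A2" "rep 0 z w = ip (rep 0 z) (\<lambda>z. K' z w)"
        using K' True rep_in_A2[of z 0] by (auto simp: is_reproducing_kernel_def)
      have "K' z w = ip (\<lambda>z. K' z w) (rep 0 z)"
        using ip_rep[of z "\<lambda>z. K' z w" 0] True A(1) by simp
      also have "\<dots> = cnj (rep 0 z w)"
        unfolding A(2) by (rule ip_cnj[symmetric])
      also have "rep 0 z w = jet 0 0 w z"
        using True by (simp add: jet_eq_deriv)
      finally show ?thesis
        using True by (simp add: cnj_jet K_def)
    qed (use K' in \<open>auto simp: K_def\<close>)
    then show "K' = K"
      by (intro ext)
  qed
  then show ?thesis
    using assms by (simp add: K_def)
qed

section \<open>Positivity of the Kobayashi--Fuks metric\<close>

definition comb :: "complex \<Rightarrow> complex \<Rightarrow> complex \<Rightarrow> complex \<Rightarrow> complex \<Rightarrow> complex" where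
  "comb p a b c = (\<lambda>x. a * rep 0 p x + b * rep 1 p x + c * rep 2 p x)"

lemma comb_in_A2: "p \<in> D \<Longrightarrow> comb p a b c \<in> A2"
  unfolding comb_def by (intro A2_add A2_scale rep_in_A2)

lemma ip_comb_left:
  "p \<in> D \<Longrightarrow> h \<in> A2 \<Longrightarrow> ip (comb p a b c) h = a * ip (rep 0 p) h + b * ip (rep 1 p) h + c * ip (rep 2 p) h"
  unfolding comb_def by (simp add: ip_add_left ip_scale_left A2_add A2_scale rep_in_A2)

lemma ip_comb_right:
  assumes "p \<in> D" "h \<in> A2"
  shows "ip h (comb p a b c) = cnj a * ip h (rep 0 p) + cnj b * ip h (rep 1 p) + cnj c * ip h (rep 2 p)"
  using arg_cong[OF ip_comb_left[OF assms, of a b c], of cnj] by (simp add: ip_cnj)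

lemma sqnorm_comb:
  assumes p: "p \<in> D"
  shows "complex_of_real (sqnorm (comb p a b c)) =
      cnj a * (a * jet 0 0 p p + b * jet 0 1 p p + c * jet 0 2 p p)
    + cnj b * (a * jet 1 0 p p + b * jet 1 1 p p + c * jet 1 2 p p)
    + cnj c * (a * jet 2 0 p p + b * jet 2 1 p p + c * jet 2 2 p p)"
  unfolding ip_self[symmetric] ip_comb_right[OF p comb_in_A2[OF p]] ip_comb_left[OF p rep_in_A2[OF p]] jet_def ..

text \<open>A combination of norm zero would be orthogonal to \<open>(\<zeta> - p)\<^sup>n\<close> for \<open>n = 0, 1, 2\<close>, and the inner product
with the \<open>n\<close>-th of these is \<open>n!\<close> times the conjugate of the \<open>n\<close>-th coefficient.\<close>

lemma sqnorm_comb_pos: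
  assumes p: "p \<in> D" and nz: "a \<noteq> 0 \<or> b \<noteq> 0 \<or> c \<noteq> 0"
  shows "0 < sqnorm (comb p a b c)"
proof (rule ccontr)
  assume "\<not> ?thesis"
  then have "sqnorm (comb p a b c) = 0"
    using sqnorm_nonneg[of "comb p a b c"] by simp
  then have orth: "ip h (comb p a b c) = 0" if "h \<in> A2" for h
    using that by (intro minimal_imp_orthogonal[OF comb_in_A2[OF p]]) (simp_all add: sqnorm_nonneg)
  have "cnj a * (deriv ^^ 0) (\<lambda>z. (z - p) ^ n) p + cnj b * (deriv ^^ 1) (\<lambda>z. (z - p) ^ n) p
      + cnj c * (deriv ^^ 2) (\<lambda>z. (z - p) ^ n) p = 0" for n
    using orth[OF power_diff_in_A2[of p n]] unfolding ip_comb_right[OF p power_diff_in_A2]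
    by (simp only: ip_rep[OF p power_diff_in_A2])
  note eq = this[unfolded higher_deriv_power_diff_at]
  from eq[of 0] eq[of 1] eq[of 2] nz show False
    by simp
qed

text \<open>The Gram determinant \<open>M\<close> of \<open>e\<^sub>0, e\<^sub>1\<close>. The next three definitions are its derivatives
after cancellation, as \<open>gram2_has_wirtinger\<close> and \<open>gram2_dzbar_has_wirtinger\<close> show.\<close>

definition gram2 :: "complex \<Rightarrow> complex" where
  "gram2 z = jet 0 0 z z * jet 1 1 z z - jet 1 0 z z * jet 0 1 z z"

definition gram2_dz :: "complex \<Rightarrow> complex" where
  "gram2_dz z = jet 0 0 z z * jet 2 1 z z - jet 2 0 z z * jet 0 1 z z"

definition gram2_dzbar :: "complex \<Rightarrow> complex" where
  "gram2_dzbar z = jet 0 0 z z * jet 1 2 z z - jet 1 0 z z * jet 0 2 z z"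

definition gram2_dz_dzbar :: "complex \<Rightarrow> complex" where
  "gram2_dz_dzbar z = jet 0 0 z z * jet 2 2 z z - jet 2 0 z z * jet 0 2 z z"

lemma jet_has_wirtinger_012:
  assumes "p \<in> D"
  shows "has_wirtinger (\<lambda>z. jet 0 0 z z) (jet 1 0 p p) (jet 0 1 p p) p"
    "has_wirtinger (\<lambda>z. jet 0 1 z z) (jet 1 1 p p) (jet 0 2 p p) p"
    "has_wirtinger (\<lambda>z. jet 1 0 z z) (jet 2 0 p p) (jet 1 1 p p) p"
    "has_wirtinger (\<lambda>z. jet 1 1 z z) (jet 2 1 p p) (jet 1 2 p p) p"
    "has_wirtinger (\<lambda>z. jet 0 2 z z) (jet 1 2 p p) (jet 0 3 p p) p"
    "has_wirtinger (\<lambda>z. jet 1 2 z z) (jet 2 2 p p) (jet 1 3 p p) p"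
  using jet_has_wirtinger[OF assms, of 0 0] jet_has_wirtinger[OF assms, of 0 1]
    jet_has_wirtinger[OF assms, of 1 0] jet_has_wirtinger[OF assms, of 1 1]
    jet_has_wirtinger[OF assms, of 0 2] jet_has_wirtinger[OF assms, of 1 2]
  by (simp_all add: numeral_2_eq_2 numeral_3_eq_3)

lemma gram2_has_wirtinger:
  assumes "p \<in> D"
  shows "has_wirtinger gram2 (gram2_dz p) (gram2_dzbar p) p"
  using has_wirtinger_diff[OF has_wirtinger_mult[OF jet_has_wirtinger_012(1,4)[OF assms]]
      has_wirtinger_mult[OF jet_has_wirtinger_012(3,2)[OF assms]]]
  by (simp add: gram2_def[abs_def] gram2_dz_def gram2_dzbar_def algebra_simps)

lemma gram2_dzbar_has_wirtinger:
  assumes "p \<in> D"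
  shows "\<exists>b. has_wirtinger gram2_dzbar (gram2_dz_dzbar p) b p"
  using has_wirtinger_diff[OF has_wirtinger_mult[OF jet_has_wirtinger_012(1,6)[OF assms]]
      has_wirtinger_mult[OF jet_has_wirtinger_012(3,5)[OF assms]]]
  by (intro exI) (simp add: gram2_dzbar_def[abs_def] gram2_dz_dzbar_def algebra_simps)

lemma jet_00_pos:
  assumes "p \<in> D"
  obtains k where "0 < k" "jet 0 0 p p = complex_of_real k"
  using that sqnorm_comb_pos[OF assms, of 1 0 0] sqnorm_comb[OF assms, of 1 0 0] by simp

text \<open>The vector \<open>g\<^sub>0\<^sub>0 e\<^sub>1 - g\<^sub>0\<^sub>1 e\<^sub>0\<close> is the part of \<open>e\<^sub>1\<close> orthogonal to \<open>e\<^sub>0\<close>, cleared of denominators; its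
squared norm is \<open>g\<^sub>0\<^sub>0 M\<close>.\<close>

lemma gram2_pos:
  assumes p: "p \<in> D"
  obtains m where "0 < m" "gram2 p = complex_of_real m"
proof -
  obtain k where k: "0 < k" "jet 0 0 p p = complex_of_real k"
    using jet_00_pos[OF p] .
  define s where "s = sqnorm (comb p (- jet 0 1 p p) (jet 0 0 p p) 0)"
  have "0 < s"
    unfolding s_def using k by (intro sqnorm_comb_pos[OF p]) simp
  have "complex_of_real s = jet 0 0 p p * gram2 p"
    unfolding s_def sqnorm_comb[OF p] by (simp add: cnj_jet gram2_def algebra_simps)
  then have "gram2 p = complex_of_real (s / k)"
    using k by (simp add: field_simps)
  then show thesis
    using that[of "s / k"] \<open>0 < s\<close> k(1) by simp
qed

text \<open>With \<open>b\<^sub>k = g\<^sub>0\<^sub>0 e\<^sub>k - g\<^sub>0\<^sub>k e\<^sub>0\<close> for \<open>k = 1, 2\<close>, the vector \<open>M b\<^sub>2 - M\<^sub>2 b\<^sub>1\<close> is orthogonal to \<open>e\<^sub>0\<close> and \<open>e\<^sub>1\<close>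
(one step of Gram--Schmidt without denominators), so that its squared norm comes from its \<open>e\<^sub>2\<close>
component alone and is \<open>g\<^sub>0\<^sub>0 M (M M\<^sub>1\<^sub>2 - M\<^sub>1 M\<^sub>2)\<close>.\<close>

lemma gram3_pos:
  assumes p: "p \<in> D"
  obtains t where "0 < t" "gram2 p * gram2_dz_dzbar p - gram2_dz p * gram2_dzbar p = complex_of_real t"
proof -
  obtain k where k: "0 < k" "jet 0 0 p p = complex_of_real k"
    using jet_00_pos[OF p] .
  obtain m where m: "0 < m" "gram2 p = complex_of_real m"
    using gram2_pos[OF p] .
  define a b c where "a = gram2_dzbar p * jet 0 1 p p - gram2 p * jet 0 2 p p"
    and "b = - (gram2_dzbar p * jet 0 0 p p)" and "c = gram2 p * jet 0 0 p p"
  define s where "s = sqnorm (comb p a b c)"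
  have "0 < s"
    unfolding s_def using k m by (intro sqnorm_comb_pos[OF p]) (simp add: c_def)
  have cnj_c: "cnj c = gram2 p * jet 0 0 p p"
    by (simp add: c_def k m)
  \<comment> \<open>the rows are the inner products of the vector with \<open>e\<^sub>0\<close>, \<open>e\<^sub>1\<close> and \<open>e\<^sub>2\<close>\<close>
  have row0: "a * jet 0 0 p p + b * jet 0 1 p p + c * jet 0 2 p p = 0"
    by (simp add: a_def b_def c_def algebra_simps)
  have row1: "a * jet 1 0 p p + b * jet 1 1 p p + c * jet 1 2 p p = 0"
    by (simp add: a_def b_def c_def gram2_def gram2_dzbar_def algebra_simps)
  have row2: "a * jet 2 0 p p + b * jet 2 1 p p + c * jet 2 2 p p
      = gram2 p * gram2_dz_dzbar p - gram2_dz p * gram2_dzbar p"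
    by (simp add: a_def b_def c_def gram2_dz_def gram2_dz_dzbar_def algebra_simps)
  have "complex_of_real s =
      jet 0 0 p p * gram2 p * (gram2 p * gram2_dz_dzbar p - gram2_dz p * gram2_dzbar p)"
    unfolding s_def sqnorm_comb[OF p] row0 row1 row2 cnj_c by simp
  then have "gram2 p * gram2_dz_dzbar p - gram2_dz p * gram2_dzbar p = complex_of_real (s / (k * m))"
    using k m by (simp add: field_simps)
  then show thesis
    using that[of "s / (k * m)"] \<open>0 < s\<close> k(1) m(1) by simp
qed

lemma bergman_metric_eq:
  assumes p: "p \<in> D"
  shows "complex_of_real ((bergman_kernel_diag D p)\<^sup>2 * bergman_metric D p) = gram2 p"
proof -
  have diag: "complex_of_real (bergman_kernel_diag D z) = jet 0 0 z z" "0 < bergman_kernel_diag D z"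
    if z: "z \<in> D" for z
  proof -
    obtain k where "0 < k" "jet 0 0 z z = complex_of_real k"
      using jet_00_pos[OF z] .
    then show "complex_of_real (bergman_kernel_diag D z) = jet 0 0 z z" "0 < bergman_kernel_diag D z"
      by (simp_all add: bergman_kernel_diag_def bergman_kernel_eq_jet z)
  qed
  have "bergman_metric D p = Re (gram2 p / (jet 0 0 p p)\<^sup>2)"
    unfolding bergman_metric_def gram2_def
    by (rule dz_dzbar_ln[OF open_D p diag jet_has_wirtinger_012(1) jet_has_wirtinger_012(2)[OF p]])
  moreover obtain m where "0 < m" and m: "gram2 p = complex_of_real m"
    using gram2_pos[OF p] .
  ultimately have "bergman_metric D p = m / (bergman_kernel_diag D p)\<^sup>2"
    unfolding m diag(1)[OF p, symmetric] by (simp flip: of_real_power of_real_divide)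
  then show ?thesis
    using diag(2)[OF p] m by simp
qed

lemma kobayashi_fuks_metric_pos:
  assumes p: "p \<in> D"
  shows "0 < kobayashi_fuks_metric D p"
proof -
  obtain b where b: "has_wirtinger gram2_dzbar (gram2_dz_dzbar p) b p"
    using gram2_dzbar_has_wirtinger[OF p] by blast
  have pos: "0 < (bergman_kernel_diag D z)\<^sup>2 * bergman_metric D z" if z: "z \<in> D" for z
    using gram2_pos[OF z] bergman_metric_eq[OF z] by (metis of_real_eq_iff)
  have kf: "kobayashi_fuks_metric D p =
      Re ((gram2 p * gram2_dz_dzbar p - gram2_dz p * gram2_dzbar p) / (gram2 p)\<^sup>2)"
    unfolding kobayashi_fuks_metric_def
    by (rule dz_dzbar_ln[OF open_D p bergman_metric_eq pos gram2_has_wirtinger b])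
  obtain t where t: "0 < t"
    "gram2 p * gram2_dz_dzbar p - gram2_dz p * gram2_dzbar p = complex_of_real t"
    using gram3_pos[OF p] .
  obtain m where m: "0 < m" "gram2 p = complex_of_real m"
    using gram2_pos[OF p] .
  have "kobayashi_fuks_metric D p = Re (complex_of_real t / (complex_of_real m)\<^sup>2)"
    unfolding kf unfolding t(2) unfolding m(2) ..
  also have "\<dots> = t / m\<^sup>2"
    by (simp flip: of_real_power of_real_divide)
  finally show ?thesis
    using t(1) m(1) by simp
qed

end

theorem corollary1p3:
  fixes D D' :: "complex set" and f :: "complex \<Rightarrow> complex"
  assumes "C2_smoothly_bounded_domain D"
    and "C2_smoothly_bounded_domain D'"
    and "riemannian_isometry D (kobayashi_fuks_metric D) D' (kobayashi_fuks_metric D') f"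
  shows "f holomorphic_on D \<or> (\<lambda>z. cnj (f z)) holomorphic_on D"
proof -
  interpret D: bounded_open D
    using assms(1) by unfold_locales (simp_all add: C2_smoothly_bounded_domain_def)
  interpret D': bounded_open D'
    using assms(2) by unfold_locales (simp_all add: C2_smoothly_bounded_domain_def)
  have "connected D"
    using assms(1) by (simp add: C2_smoothly_bounded_domain_def)
  then show ?thesis
    using riemannian_isometry_imp_holomorphic_or_antiholomorphic[OF D.open_D _ assms(3)]
      D.kobayashi_fuks_metric_pos D'.kobayashi_fuks_metric_pos by blast
qed

end
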